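(* Let $F:\mathbb{R}^d\to\mathbb{R}$ be lower bounded by $F^*$ with $\Delta_1\ge F(x_1)-F^*$, $\Delta_1>0$, let $F$ be $L$-smooth with $L>0$, and let the gradient oracle satisfy the $p$-BCM assumption with $p\in(1,2]$ and constant $\sigma\ge0$. Let $\delta\in(0,1)$ and $T\ge1$. Then the iterates generated by minibatch-NSGD with parameters $\eta_t\equiv\sqrt{\frac{\Delta_1}{LT}}$ and $B_t\equiv\left\lceil\max\left\{1,\left(\frac{\sigma^2T}{\Delta_1L}\right)^{\frac{p}{2p-2}}\right\}\right\rceil$ satisfy, with probability at least $1-\delta$, $$\frac1T\sum_{t=1}^T\|\nabla F(x_t)\|\le\big(11+30\log(1/\delta)\big)\frac{\sqrt{\Delta_1L}}{\sqrt T}.$$ This corresponds to a sample complexity (number of oracle calls sufficient, for a suitable $T$, to guarantee $\frac1T\sum_{t=1}^T\|\nabla F(x_t)\|\le\varepsilon$ with probability at least $1-\delta$) of $$\widetilde{\mathcal{O}}\left(\frac{\Delta_1L}{\varepsilon^2}+\frac{\Delta_1L}{\varepsilon^2}\Big(\frac{\sigma}{\varepsilon}\Big)^{\frac{p}{p-1}}\right).$$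
   Context: Assumptions. (Lower boundedness) $F\ge F^*>-\infty$ on $\mathbb{R}^d$, and $\Delta_1\ge F(x_1)-F^*$ is a given upper bound on the initialization gap. ($L$-smoothness) $F$ is differentiable and $\|\nabla F(x)-\nabla F(y)\|\le L\|x-y\|$ for all $x,y\in\mathbb{R}^d$. ($p$-BCM) for all $x\in\mathbb{R}^d$: $\mathbb{E}[\nabla f(x,\xi)]=\nabla F(x)$ and $\mathbb{E}[\|\nabla f(x,\xi)-\nabla F(x)\|^p]\le\sigma^p$, where $\nabla f(\cdot,\xi)$ is the stochastic gradient oracle. minibatch-NSGD: from a deterministic initial point $x_1$, iterate $x_{t+1}=x_t-\eta_t\, g_t/\|g_t\|$ with $g_t=\frac1{B_t}\sum_{j=1}^{B_t}\nabla f(x_t,\xi_t^{(j)})$, where all $\xi_t^{(j)}$ (over all $t$ and $j$) are independent copies of $\xi$. Convention: $g/\|g\|:=0$ if $g=0$. A run with horizon $T$ uses $\sum_{t=1}^TB_t$ oracle calls. The notation $\widetilde{\mathcal{O}}(\cdot)$ means: at most $C(1+\log(1/\delta))^k$ times the displayed expression, with $C,k$ depending only on $p$, for all sufficiently small $\varepsilon>0$ (the threshold may depend on $\Delta_1,L,\sigma$). *)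

theory Defs
  imports "HOL-Probability.Probability"
begin

definition gradient :: "('a::real_inner \<Rightarrow> real) \<Rightarrow> 'a \<Rightarrow> 'a" where
  "gradient F x = (THE g. GDERIV F x :> g)"

definition L_smooth :: "real \<Rightarrow> ('a::real_inner \<Rightarrow> real) \<Rightarrow> bool" where
  "L_smooth L F \<longleftrightarrow>
     (\<forall>x. F differentiable (at x)) \<and>
     (\<forall>x y. norm (gradient F x - gradient F y) \<le> L * norm (x - y))"

text \<open>
  \<open>D\<close> is the law of the noise variable and \<open>G x s\<close> the value of the oracle at the point \<open>x\<close>
  under the noise value \<open>s\<close>. Joint measurability of \<open>G\<close> makes oracle calls at random points
  random variables. The two integrability conditions say that the expectations exist and are
  finite; the Bochner integral of a function that is not integrable is \<open>0\<close>.
\<close>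

definition p_BCM ::
  "real \<Rightarrow> real \<Rightarrow> ('a::euclidean_space \<Rightarrow> real) \<Rightarrow> 's measure \<Rightarrow> ('a \<Rightarrow> 's \<Rightarrow> 'a) \<Rightarrow> bool" where
  "p_BCM p \<sigma> F D G \<longleftrightarrow>
     prob_space D \<and>
     (\<lambda>(x, s). G x s) \<in> borel_measurable (borel \<Otimes>\<^sub>M D) \<and>
     (\<forall>x. integrable D (G x) \<and>
          (\<integral>s. G x s \<partial>D) = gradient F x \<and>
          integrable D (\<lambda>s. norm (G x s - gradient F x) powr p) \<and>
          (\<integral>s. norm (G x s - gradient F x) powr p \<partial>D) \<le> \<sigma> powr p)"

text \<open>
  \<open>\<xi> t j\<close> is the noise of the \<open>j\<close>-th oracle call in iteration \<open>t\<close>; only the calls made by a run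
  with horizon \<open>T\<close> and batch sizes \<open>B\<close> are constrained.
\<close>

definition independent_copies ::
  "'w measure \<Rightarrow> 's measure \<Rightarrow> nat \<Rightarrow> (nat \<Rightarrow> nat) \<Rightarrow> (nat \<Rightarrow> nat \<Rightarrow> 'w \<Rightarrow> 's) \<Rightarrow> bool" where
  "independent_copies M D T B \<xi> \<longleftrightarrow>
     prob_space M \<and>
     prob_space.indep_vars M (\<lambda>_. D) (\<lambda>(t, j). \<xi> t j) (SIGMA t:{1..T}. {1..B t}) \<and>
     (\<forall>t\<in>{1..T}. \<forall>j\<in>{1..B t}. distr M D (\<xi> t j) = D)"

definition minibatch_gradient ::
  "('a::real_vector \<Rightarrow> 's \<Rightarrow> 'a) \<Rightarrow> (nat \<Rightarrow> nat) \<Rightarrow> (nat \<Rightarrow> nat \<Rightarrow> 'w \<Rightarrow> 's) \<Rightarrow> nat \<Rightarrow> 'a \<Rightarrow> 'w \<Rightarrow> 'a" where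
  "minibatch_gradient G B \<xi> t x \<omega> = (1 / real (B t)) *\<^sub>R (\<Sum>j=1..B t. G x (\<xi> t j \<omega>))"

text \<open>
  Iterations are counted from \<open>1\<close>; the value at index \<open>0\<close> is irrelevant. In a normed space,
  \<open>sgn g\<close> is \<open>g\<close> divided by its norm, with \<open>sgn 0 = 0\<close>.
\<close>

primrec minibatch_nsgd ::
  "('a::real_normed_vector \<Rightarrow> 's \<Rightarrow> 'a) \<Rightarrow> 'a \<Rightarrow> (nat \<Rightarrow> real) \<Rightarrow> (nat \<Rightarrow> nat) \<Rightarrow>
   (nat \<Rightarrow> nat \<Rightarrow> 'w \<Rightarrow> 's) \<Rightarrow> nat \<Rightarrow> 'w \<Rightarrow> 'a" where
  "minibatch_nsgd G x1 \<eta> B \<xi> 0 \<omega> = x1"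
| "minibatch_nsgd G x1 \<eta> B \<xi> (Suc t) \<omega> =
     (if t = 0 then x1
      else minibatch_nsgd G x1 \<eta> B \<xi> t \<omega> -
           \<eta> t *\<^sub>R sgn (minibatch_gradient G B \<xi> t (minibatch_nsgd G x1 \<eta> B \<xi> t \<omega>) \<omega>))"

definition avg_gradient_norm :: "('a::real_inner \<Rightarrow> real) \<Rightarrow> (nat \<Rightarrow> 'w \<Rightarrow> 'a) \<Rightarrow> nat \<Rightarrow> 'w \<Rightarrow> real" where
  "avg_gradient_norm F x T \<omega> = (1 / real T) * (\<Sum>t=1..T. norm (gradient F (x t \<omega>)))"

definition oracle_calls :: "(nat \<Rightarrow> nat) \<Rightarrow> nat \<Rightarrow> nat" where
  "oracle_calls B T = (\<Sum>t=1..T. B t)"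

definition nsgd_step :: "real \<Rightarrow> real \<Rightarrow> nat \<Rightarrow> nat \<Rightarrow> real" where
  "nsgd_step \<Delta>\<^sub>1 L T = (\<lambda>t. sqrt (\<Delta>\<^sub>1 / (L * real T)))"

definition nsgd_batch :: "real \<Rightarrow> real \<Rightarrow> real \<Rightarrow> real \<Rightarrow> nat \<Rightarrow> nat \<Rightarrow> nat" where
  "nsgd_batch p \<sigma> \<Delta>\<^sub>1 L T =
     (\<lambda>t. nat \<lceil>max 1 ((\<sigma>\<^sup>2 * real T / (\<Delta>\<^sub>1 * L)) powr (p / (2 * p - 2)))\<rceil>)"

text \<open>
  The least horizon \<open>T\<close> with
  \<open>(11 + 30 * ln (1 / \<delta>)) * sqrt (\<Delta>\<^sub>1 * L) / sqrt T \<le> \<epsilon>\<close>. Naming it, instead of asserting the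
  existence of a suitable horizon, makes the number of oracle calls an expression in real
  parameters only. Constants bounding that number then cannot depend on the dimension or the
  probability spaces, which are represented by types and cannot be quantified inside a formula.
\<close>

definition nsgd_horizon :: "real \<Rightarrow> real \<Rightarrow> real \<Rightarrow> real \<Rightarrow> nat" where
  "nsgd_horizon \<Delta>\<^sub>1 L \<delta> \<epsilon> = nat \<lceil>(11 + 30 * ln (1 / \<delta>))\<^sup>2 * (\<Delta>\<^sub>1 * L) / \<epsilon>\<^sup>2\<rceil>"

end

theory Submission
  imports Defs
begin

text \<open>
  The normalized step turns the descent lemma into a bound on
  \<open>\<Sum>t. \<nabla>F(x\<^sub>t) \<bullet> sgn g\<^sub>t\<close>, and \<open>a \<bullet> sgn g \<ge> \<parallel>a\<parallel> - 2\<parallel>g - a\<parallel>\<close> relates each summand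
  in expectation to \<open>\<parallel>\<nabla>F(x\<^sub>t)\<parallel>\<close>. The von Bahr--Esseen inequality and the choice of the
  batch size bound the mean error of \<open>g\<^sub>t\<close> by \<open>2\<kappa>\<close>, where \<open>\<kappa> = sqrt(\<Delta>\<^sub>1 L / T)\<close>. The summands
  are bounded by \<open>\<parallel>\<nabla>F(x\<^sub>t)\<parallel>\<close> however heavy the tails of the noise are, so Hoeffding's lemma makes
  \<open>exp(l \<Sum>t. (\<parallel>\<nabla>F(x\<^sub>t)\<parallel> - \<nabla>F(x\<^sub>t) \<bullet> sgn g\<^sub>t - l/2 \<parallel>\<nabla>F(x\<^sub>t)\<parallel>\<^sup>2 - 4\<kappa>))\<close> a supermartingale, and
  Markov's inequality applies. Since steps have length at most \<open>\<eta>\<close>, the gradients on the trajectory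
  never exceed \<open>3\<kappa>T\<close>; for \<open>l = 1 / (3\<kappa>T)\<close> the quadratic term is therefore absorbed by half of the
  linear one.
\<close>

subsection \<open>Moments of sums of independent vectors\<close>

lemma powr_le_Bernoulli:
  fixes u a :: real
  assumes "0 \<le> u" "0 < a" "a \<le> 1"
  shows "u powr a \<le> 1 + a * (u - 1)"
proof (cases "u = 0")
  case False
  \<comment> \<open>Weighted AM-GM for \<open>u\<close> and \<open>1\<close> with weights
    \<open>a\<close> and \<open>1 - a\<close>.\<close>
  then show ?thesis
    using Youngs_inequality_0[of a "1 - a" u 1] assms by (simp add: algebra_simps)
qed (use assms in simp)

text \<open>The convex case is the concave one for \<open>u powr p\<close> with exponent
  \<open>1 / p\<close>.\<close>

lemma powr_ge_Bernoulli:
  fixes u p :: real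
  assumes "0 \<le> u" "1 \<le> p"
  shows "1 + p * (u - 1) \<le> u powr p"
proof -
  have "(u powr p) powr (1 / p) \<le> 1 + 1 / p * (u powr p - 1)"
    using assms by (intro powr_le_Bernoulli) auto
  then show ?thesis
    using assms by (simp add: powr_powr field_simps)
qed

text \<open>Scalar form of \<open>norm_add_powr_le\<close> after division by
  \<open>norm x powr p\<close>: \<open>r\<close> is the ratio of the norms, \<open>s\<close> the
  normalized inner product, and the bound on \<open>s\<close> is Cauchy-Schwarz. For
  \<open>r \<le> 1\<close> the tangent at \<open>1\<close> suffices; for larger \<open>r\<close> the
  factor \<open>r\<^sup>2\<close> is taken out first.\<close>

lemma powr_quadratic_le:
  fixes r s p :: real
  assumes p: "1 < p" "p \<le> 2" and r: "0 < r" and s: "\<bar>s\<bar> \<le> r"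
  shows "(1 + 2 * s + r\<^sup>2) powr (p / 2) \<le> 1 + p * s + 2 * r powr p"
proof -
  have nonneg: "0 \<le> 1 + 2 * s + r\<^sup>2"
  proof -
    have "0 \<le> (1 - r)\<^sup>2" by simp
    also have "\<dots> = 1 - 2 * r + r\<^sup>2" by (simp add: power2_eq_square algebra_simps)
    finally show ?thesis using s by linarith
  qed
  show ?thesis
  proof (cases "r \<le> 1")
    case True
    have "(1 + 2 * s + r\<^sup>2) powr (p / 2) \<le> 1 + p / 2 * ((1 + 2 * s + r\<^sup>2) - 1)"
      using nonneg p by (intro powr_le_Bernoulli) auto
    also have "\<dots> = 1 + p * s + p / 2 * r\<^sup>2" by (simp add: algebra_simps)
    also have "p / 2 * r\<^sup>2 \<le> 1 * r powr p"
    proof (rule mult_mono)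
      show "r\<^sup>2 \<le> r powr p"
        using powr_mono'[of p 2 r] r p True by (simp add: powr_numeral)
    qed (use p in auto)
    also have "1 + p * s + 1 * r powr p \<le> 1 + p * s + 2 * r powr p"
      by simp
    finally show ?thesis by simp
  next
    case False
    then have r1: "1 \<le> r" by simp
    \<comment> \<open>For large \<open>r\<close> the quotient \<open>v\<close> is close to
      \<open>1\<close>, so the tangent at \<open>1\<close> is accurate again; its linear term then
      carries the factor \<open>c\<close>.\<close>
    define v where "v = (1 + 2 * s + r\<^sup>2) / r\<^sup>2"
    define c where "c = r powr (p - 2)"
    have c: "0 < c" "c \<le> 1"
      using r r1 p powr_mono[of "p - 2" 0 r] by (auto simp: c_def)
    have rc: "r\<^sup>2 * c = r powr p" "r * c = r powr (p - 1)"
      using r by (simp_all add: c_def powr_mult_base powr_numeral[symmetric] powr_add[symmetric]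
        del: powr_numeral)
    have "(1 + 2 * s + r\<^sup>2) powr (p / 2) = (r\<^sup>2 * v) powr (p / 2)"
      using r by (simp add: v_def)
    also have "\<dots> = (r\<^sup>2) powr (p / 2) * v powr (p / 2)"
      by (rule powr_mult)
    also have "(r\<^sup>2) powr (p / 2) = r powr p"
      using r by (simp add: powr_numeral[symmetric] powr_powr del: powr_numeral)
    also have "r powr p * v powr (p / 2) \<le> r powr p * (1 + p / 2 * (v - 1))"
      using nonneg p by (intro mult_left_mono powr_le_Bernoulli) (auto simp: v_def)
    also have "\<dots> = r powr p + p / 2 * c * (1 + 2 * s)"
      using r by (simp add: rc(1)[symmetric] v_def field_simps)
    also have "\<dots> = r powr p + p / 2 * c + p * (c * s)"
      by (simp add: field_simps)
    finally have 1: "(1 + 2 * s + r\<^sup>2) powr (p / 2) \<le> r powr p + p / 2 * c + p * (c * s)" .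
    \<comment> \<open>Restores the coefficient of \<open>p * s\<close> from \<open>c\<close> to
      \<open>1\<close>. By \<open>s \<ge> - r\<close> this costs at most
      \<open>p * r - p * r powr (p - 1)\<close>, which facts 3 and 4 bound by
      \<open>r powr p - 1\<close>.\<close>
    have "(1 - c) * (- r) \<le> (1 - c) * s"
      using c s by (intro mult_left_mono) auto
    then have "p * ((1 - c) * (- r)) \<le> p * ((1 - c) * s)"
      by (rule mult_left_mono) (use p in simp)
    then have 2: "p * r powr (p - 1) - p * r \<le> p * s - p * (c * s)"
      by (simp add: rc(2)[symmetric] algebra_simps)
    have 3: "1 + p * (r - 1) \<le> r powr p"
      using r p by (intro powr_ge_Bernoulli) auto
    have 4: "p \<le> p * r powr (p - 1)"
      using r1 p by (simp add: ge_one_powr_ge_zero)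
    have "p / 2 * c \<le> 1 * 1"
      using p c by (intro mult_mono) auto
    moreover have "1 + p * r - p \<le> r powr p"
      using 3 by (simp add: algebra_simps)
    ultimately show ?thesis
      using 1 2 4 by linarith
  qed
qed

text \<open>First-order expansion of the \<open>p\<close>-th power of the norm at \<open>x\<close>.
  The middle term is the derivative in direction \<open>y\<close>, which averages out for
  independent centered \<open>y\<close>; at \<open>x = 0\<close> it vanishes.\<close>

lemma norm_add_powr_le:
  fixes x y :: "'a::real_inner" and p :: real
  assumes p: "1 < p" "p \<le> 2"
  shows "norm (x + y) powr p \<le>
    norm x powr p + p * (norm x powr (p - 2) * (x \<bullet> y)) + 2 * norm y powr p"
proof (cases "x = 0 \<or> y = 0")
  case False
  define a where "a = norm x"
  define r where "r = norm y / norm x"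
  define s where "s = (x \<bullet> y) / (norm x)\<^sup>2"
  have a: "a > 0" and r: "r > 0" using False by (auto simp: a_def r_def)
  have "\<bar>x \<bullet> y\<bar> \<le> norm x * norm y" by (rule Cauchy_Schwarz_ineq2)
  then have s: "\<bar>s\<bar> \<le> r"
    using False by (simp add: s_def r_def field_simps power2_eq_square)
  have eq: "(norm (x + y))\<^sup>2 = a\<^sup>2 * (1 + 2 * s + r\<^sup>2)"
  proof -
    have "(norm (x + y))\<^sup>2 = a\<^sup>2 + 2 * (x \<bullet> y) + (norm y)\<^sup>2"
      by (simp add: a_def power2_norm_eq_inner inner_add algebra_simps inner_commute)
    also have "\<dots> = a\<^sup>2 * (1 + 2 * s + r\<^sup>2)"
      using False by (simp add: a_def s_def r_def field_simps)
    finally show ?thesis .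
  qed
  have nonneg: "0 \<le> 1 + 2 * s + r\<^sup>2"
    using eq a by (metis zero_le_mult_iff zero_le_power2 not_le zero_less_power)
  have "norm (x + y) powr p = ((norm (x + y))\<^sup>2) powr (p / 2)"
    by (simp add: powr_numeral[symmetric] powr_powr del: powr_numeral)
  also have "\<dots> = a powr p * (1 + 2 * s + r\<^sup>2) powr (p / 2)"
    unfolding eq using nonneg a
    by (simp add: powr_mult powr_numeral[symmetric] powr_powr del: powr_numeral)
  also have "\<dots> \<le> a powr p * (1 + p * s + 2 * r powr p)"
    using powr_quadratic_le[OF p r s] by (intro mult_left_mono) auto
  also have "\<dots> = a powr p + p * (a powr p * s) + 2 * (a * r) powr p"
    using a r by (simp add: powr_mult algebra_simps)
  also have "a powr p * s = a powr (p - 2) * (x \<bullet> y)"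
    using a by (simp add: powr_diff s_def a_def[symmetric] powr_numeral)
  also have "a * r = norm y" using False by (simp add: a_def r_def)
  finally show ?thesis by (simp add: a_def)
qed auto

section \<open>The von Bahr--Esseen inequality and sample means\<close>

lemma (in prob_space) indep_vars_sum_vector:
  fixes X :: "'i \<Rightarrow> 'a \<Rightarrow> 'b::euclidean_space"
  assumes I: "finite I" "i \<notin> I" and indep: "indep_vars (\<lambda>_. borel) X (insert i I)"
  shows "indep_var borel (X i) borel (\<lambda>\<omega>. \<Sum>i\<in>I. X i \<omega>)"
proof -
  have "indep_var
    borel ((\<lambda>f. f i) \<circ> (\<lambda>\<omega>. restrict (\<lambda>i. X i \<omega>) {i}))
    borel ((\<lambda>f. \<Sum>i\<in>I. f i) \<circ> (\<lambda>\<omega>. restrict (\<lambda>i. X i \<omega>) I))"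
    using I by (intro indep_var_compose[OF indep_var_restrict[OF indep]]) auto
  then show ?thesis by (simp add: comp_def cong: sum.cong)
qed

text \<open>Independence is used coordinate by coordinate, where the factor
  \<open>X \<omega> \<bullet> b\<close> has mean zero. The other factor grows like the power
  \<open>p - 1\<close> of the norm of \<open>S\<close>, hence is dominated by
  \<open>1 + norm (S \<omega>) powr p\<close>.\<close>

lemma (in prob_space) indep_cross_term_zero:
  fixes X S :: "'a \<Rightarrow> 'b::euclidean_space" and p :: real
  assumes p: "1 < p" and indep: "indep_var borel X borel S"
    and X: "integrable M X" "expectation X = 0"
    and S: "integrable M (\<lambda>\<omega>. norm (S \<omega>) powr p)"
  shows "integrable M (\<lambda>\<omega>. norm (S \<omega>) powr (p - 2) * (S \<omega> \<bullet> X \<omega>))"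
    and "expectation (\<lambda>\<omega>. norm (S \<omega>) powr (p - 2) * (S \<omega> \<bullet> X \<omega>)) = 0"
proof -
  have [measurable]: "S \<in> borel_measurable M" "X \<in> borel_measurable M"
    using indep_var_rv2[OF indep] indep_var_rv1[OF indep] by auto
  have int: "integrable M (\<lambda>\<omega>. norm (S \<omega>) powr (p - 2) * (S \<omega> \<bullet> b))" if "b \<in> Basis" for b
  proof (rule Bochner_Integration.integrable_bound)
    show "integrable M (\<lambda>\<omega>. 1 + norm (S \<omega>) powr p)" using S by simp
    show "AE \<omega> in M. norm (norm (S \<omega>) powr (p - 2) * (S \<omega> \<bullet> b)) \<le> norm (1 + norm (S \<omega>) powr p)"
    proof (rule AE_I2)
      fix \<omega>
      define n where "n = norm (S \<omega>)"
      have "norm (n powr (p - 2) * (S \<omega> \<bullet> b)) \<le> n powr (p - 2) * n"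
        using Basis_le_norm[OF that, of "S \<omega>"] by (simp add: abs_mult n_def mult_left_mono)
      also have "\<dots> = n powr (p - 1)"
        using powr_mult_base[of n "p - 2"] by (simp add: n_def mult.commute)
      also have "\<dots> \<le> 1 + n powr p"
      proof (cases "n \<le> 1")
        case True
        then have "n powr (p - 1) \<le> 1" using p by (intro powr_le1) (auto simp: n_def)
        then show ?thesis by (simp add: add_increasing2)
      next
        case False
        then have "n powr (p - 1) \<le> n powr p" by (intro powr_mono) auto
        then show ?thesis by simp
      qed
      finally show "norm (norm (S \<omega>) powr (p - 2) * (S \<omega> \<bullet> b)) \<le> norm (1 + norm (S \<omega>) powr p)"
        by (simp add: n_def)
    qed
  qed measurable
  have ind: "indep_var borel (\<lambda>\<omega>. X \<omega> \<bullet> b) borel (\<lambda>\<omega>. norm (S \<omega>) powr (p - 2) * (S \<omega> \<bullet> b))" for b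
    using indep_var_compose[OF indep, of "\<lambda>x. x \<bullet> b" borel "\<lambda>s. norm s powr (p - 2) * (s \<bullet> b)" borel]
    by (simp add: comp_def)
  have Xb: "integrable M (\<lambda>\<omega>. X \<omega> \<bullet> b)" "expectation (\<lambda>\<omega>. X \<omega> \<bullet> b) = 0" for b
    using X by auto
  have eq: "norm (S \<omega>) powr (p - 2) * (S \<omega> \<bullet> X \<omega>)
      = (\<Sum>b\<in>Basis. (X \<omega> \<bullet> b) * (norm (S \<omega>) powr (p - 2) * (S \<omega> \<bullet> b)))" for \<omega>
    by (subst euclidean_inner) (simp add: sum_distrib_left ac_simps)
  have prod: "integrable M (\<lambda>\<omega>. (X \<omega> \<bullet> b) * (norm (S \<omega>) powr (p - 2) * (S \<omega> \<bullet> b)))"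
    if "b \<in> Basis" for b
    by (rule indep_var_integrable[OF ind Xb(1) int[OF that]])
  show "integrable M (\<lambda>\<omega>. norm (S \<omega>) powr (p - 2) * (S \<omega> \<bullet> X \<omega>))"
    unfolding eq by (intro Bochner_Integration.integrable_sum prod)
  have "expectation (\<lambda>\<omega>. (X \<omega> \<bullet> b) * (norm (S \<omega>) powr (p - 2) * (S \<omega> \<bullet> b))) = 0"
    if "b \<in> Basis" for b
    using indep_var_lebesgue_integral[OF ind Xb(1) int[OF that]] Xb(2) by simp
  then show "expectation (\<lambda>\<omega>. norm (S \<omega>) powr (p - 2) * (S \<omega> \<bullet> X \<omega>)) = 0"
    unfolding eq by (subst Bochner_Integration.integral_sum) (auto intro: prod)
qed

text \<open>Summands are added one at a time: in \<open>norm_add_powr_le\<close> at the partial sum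
  the cross term has mean zero, so each summand costs at most twice its \<open>p\<close>-th moment.
  Integrability is part of the induction because the next cross term requires it.\<close>

lemma (in prob_space) von_Bahr_Esseen:
  fixes X :: "'i \<Rightarrow> 'a \<Rightarrow> 'b::euclidean_space" and p :: real
  assumes p: "1 < p" "p \<le> 2" and "finite J" and "indep_vars (\<lambda>_. borel) X J"
    and "\<And>j. j \<in> J \<Longrightarrow> integrable M (X j)" and "\<And>j. j \<in> J \<Longrightarrow> expectation (X j) = 0"
    and "\<And>j. j \<in> J \<Longrightarrow> integrable M (\<lambda>\<omega>. norm (X j \<omega>) powr p)"
  shows "integrable M (\<lambda>\<omega>. norm (\<Sum>j\<in>J. X j \<omega>) powr p) \<and>
    expectation (\<lambda>\<omega>. norm (\<Sum>j\<in>J. X j \<omega>) powr p)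
      \<le> 2 * (\<Sum>j\<in>J. expectation (\<lambda>\<omega>. norm (X j \<omega>) powr p))"
  using assms(3-)
proof (induction J rule: finite_induct)
  case (insert i J)
  define S where "S = (\<lambda>\<omega>. \<Sum>j\<in>J. X j \<omega>)"
  have "indep_vars (\<lambda>_. borel) X J"
    using insert.prems(1) by (rule indep_vars_subset) auto
  with insert have IH: "integrable M (\<lambda>\<omega>. norm (S \<omega>) powr p)"
    "expectation (\<lambda>\<omega>. norm (S \<omega>) powr p) \<le> 2 * (\<Sum>j\<in>J. expectation (\<lambda>\<omega>. norm (X j \<omega>) powr p))"
    by (auto simp: S_def)
  have indep: "indep_var borel (X i) borel S"
    unfolding S_def using insert by (intro indep_vars_sum_vector)
  have [measurable]: "X i \<in> borel_measurable M" "S \<in> borel_measurable M"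
    using indep_var_rv2[OF indep] indep_var_rv1[OF indep] by auto
  have Xi: "integrable M (X i)" "expectation (X i) = 0" "integrable M (\<lambda>\<omega>. norm (X i \<omega>) powr p)"
    using insert.prems by auto
  note cross = indep_cross_term_zero[OF p(1) indep Xi(1,2) IH(1)]
  define R where "R = (\<lambda>\<omega>. norm (S \<omega>) powr p
      + p * (norm (S \<omega>) powr (p - 2) * (S \<omega> \<bullet> X i \<omega>)) + 2 * norm (X i \<omega>) powr p)"
  have R: "integrable M R" unfolding R_def using IH cross Xi by simp
  have le: "norm (S \<omega> + X i \<omega>) powr p \<le> R \<omega>" for \<omega>
    unfolding R_def by (rule norm_add_powr_le[OF p])
  have int: "integrable M (\<lambda>\<omega>. norm (S \<omega> + X i \<omega>) powr p)"
  proof (rule Bochner_Integration.integrable_bound[OF R])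
    show "AE \<omega> in M. norm (norm (S \<omega> + X i \<omega>) powr p) \<le> norm (R \<omega>)"
      using le by (intro AE_I2) (simp add: order.trans[OF _ abs_ge_self])
  qed measurable
  have "expectation (\<lambda>\<omega>. norm (S \<omega> + X i \<omega>) powr p) \<le> expectation R"
    using int R le by (rule integral_mono)
  also have "expectation R
      = expectation (\<lambda>\<omega>. norm (S \<omega>) powr p) + 2 * expectation (\<lambda>\<omega>. norm (X i \<omega>) powr p)"
    unfolding R_def using IH cross Xi by simp
  also have "\<dots> \<le> 2 * (\<Sum>j\<in>insert i J. expectation (\<lambda>\<omega>. norm (X j \<omega>) powr p))"
    using IH insert.hyps by simp
  finally show ?case
    using int insert.hyps by (simp add: S_def add.commute)
qed simp

text \<open>The condition on \<open>card J\<close> rearranges to \<open>\<sigma> powr p \<le>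
  \<kappa> powr p * real (card J) powr (p - 1)\<close>, so the \<open>p\<close>-th moment of the
  mean is at most \<open>2 * \<kappa> powr p\<close>.\<close>

lemma (in prob_space) expectation_norm_sample_mean_le:
  fixes X :: "'i \<Rightarrow> 'a \<Rightarrow> 'b::euclidean_space" and p \<sigma> \<kappa> :: real
  assumes p: "1 < p" "p \<le> 2" and J: "finite J" "J \<noteq> {}" and X: "indep_vars (\<lambda>_. borel) X J"
    "\<And>j. j \<in> J \<Longrightarrow> integrable M (X j)" "\<And>j. j \<in> J \<Longrightarrow> expectation (X j) = 0"
    "\<And>j. j \<in> J \<Longrightarrow> integrable M (\<lambda>\<omega>. norm (X j \<omega>) powr p)"
    "\<And>j. j \<in> J \<Longrightarrow> expectation (\<lambda>\<omega>. norm (X j \<omega>) powr p) \<le> \<sigma> powr p"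
    and \<sigma>: "0 \<le> \<sigma>" and \<kappa>: "0 < \<kappa>" and card: "(\<sigma> / \<kappa>) powr (p / (p - 1)) \<le> real (card J)"
  shows "expectation (\<lambda>\<omega>. norm ((1 / real (card J)) *\<^sub>R (\<Sum>j\<in>J. X j \<omega>))) \<le> 2 * \<kappa>"
proof -
  define N where "N = real (card J)"
  define S where "S = (\<lambda>\<omega>. \<Sum>j\<in>J. X j \<omega>)"
  have N: "0 < N" using J by (simp add: N_def card_gt_0_iff)
  have S: "integrable M (\<lambda>\<omega>. norm (S \<omega>) powr p)"
    "expectation (\<lambda>\<omega>. norm (S \<omega>) powr p) \<le> 2 * (N * \<sigma> powr p)"
  proof -
    note V = von_Bahr_Esseen[OF p J(1) X(1-4)]
    show "integrable M (\<lambda>\<omega>. norm (S \<omega>) powr p)" using V by (simp add: S_def)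
    have "(\<Sum>j\<in>J. expectation (\<lambda>\<omega>. norm (X j \<omega>) powr p)) \<le> N * \<sigma> powr p"
      unfolding N_def by (rule sum_bounded_above) (rule X(5))
    then show "expectation (\<lambda>\<omega>. norm (S \<omega>) powr p) \<le> 2 * (N * \<sigma> powr p)"
      using V by (simp add: S_def)
  qed
  have S': "integrable M S" unfolding S_def by (intro Bochner_Integration.integrable_sum X)
  text \<open>Young's inequality with the scale \<open>\<kappa>\<close> replaces Jensen's and needs no \<open>p\<close>-th roots.\<close>
  have young: "norm (S \<omega>) / N \<le> (norm (S \<omega>) powr p * (N * \<kappa>) powr (- p) * \<kappa> + (p - 1) * \<kappa>) / p" for \<omega>
  proof -
    define u where "u = norm (S \<omega>) / (N * \<kappa>)"
    have "1 + p * (u - 1) \<le> u powr p"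
      using N \<kappa> p by (intro powr_ge_Bernoulli) (auto simp: u_def)
    then have "\<kappa> * (p * u) \<le> \<kappa> * (u powr p + (p - 1))"
      using \<kappa> by (intro mult_left_mono) (auto simp: algebra_simps)
    then have "\<kappa> * u \<le> (u powr p * \<kappa> + (p - 1) * \<kappa>) / p"
      using p by (simp add: field_simps)
    also have "u powr p = norm (S \<omega>) powr p * (N * \<kappa>) powr (- p)"
      using N \<kappa> by (simp add: u_def powr_divide powr_minus field_simps)
    finally show ?thesis using \<kappa> by (simp add: u_def)
  qed
  have key: "(N * \<kappa>) powr (- p) * (N * \<sigma> powr p) \<le> 1"
  proof -
    have "((\<sigma> / \<kappa>) powr (p / (p - 1))) powr (p - 1) \<le> N powr (p - 1)"
      using card p unfolding N_def by (intro powr_mono2) auto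
    then have "\<sigma> powr p \<le> \<kappa> powr p * N powr (p - 1)"
      using p \<kappa> \<sigma> by (simp add: powr_powr powr_divide divide_le_eq mult.commute)
    then have "(N * \<kappa>) powr (- p) * (N * \<sigma> powr p)
        \<le> (N * \<kappa>) powr (- p) * (N * (\<kappa> powr p * N powr (p - 1)))"
      using N by (intro mult_left_mono) auto
    also have "\<dots> = 1"
      using N \<kappa> by (simp add: powr_mult powr_minus powr_diff field_simps)
    finally show ?thesis .
  qed
  have "expectation (\<lambda>\<omega>. norm ((1 / N) *\<^sub>R S \<omega>)) = expectation (\<lambda>\<omega>. norm (S \<omega>) / N)"
    using N by simp
  also have "\<dots> \<le> expectation (\<lambda>\<omega>. (norm (S \<omega>) powr p * (N * \<kappa>) powr (- p) * \<kappa> + (p - 1) * \<kappa>) / p)"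
    using S S' by (intro integral_mono young) auto
  also have "\<dots> = (expectation (\<lambda>\<omega>. norm (S \<omega>) powr p) * (N * \<kappa>) powr (- p) * \<kappa> + (p - 1) * \<kappa>) / p"
    using S by (simp add: prob_space)
  also have "\<dots> \<le> ((2 * (N * \<sigma> powr p)) * (N * \<kappa>) powr (- p) * \<kappa> + (p - 1) * \<kappa>) / p"
    using S p \<kappa> by (intro divide_right_mono add_right_mono mult_right_mono) auto
  also have "\<dots> = (2 * ((N * \<kappa>) powr (- p) * (N * \<sigma> powr p)) + (p - 1)) * \<kappa> / p"
    by (simp add: algebra_simps)
  also have "\<dots> \<le> (2 * 1 + (p - 1)) * \<kappa> / p"
    using key p \<kappa> by (intro divide_right_mono mult_right_mono add_right_mono mult_left_mono) auto
  \<comment> \<open>The coefficient is \<open>(p + 1) / p\<close>, at most \<open>2\<close> for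
    \<open>p > 1\<close>.\<close>
  also have "\<dots> \<le> 2 * \<kappa>"
    using p \<kappa> by (simp add: field_simps)
  finally show ?thesis by (simp add: N_def S_def)
qed

subsection \<open>Smooth functions\<close>

lemma GDERIV_unique:
  assumes "GDERIV F x :> g" "GDERIV F x :> h"
  shows "g = h"
proof -
  have "(\<lambda>v. v \<bullet> g) = (\<lambda>v. v \<bullet> h)"
    using assms unfolding gderiv_def by (rule has_derivative_unique)
  then have "(g - h) \<bullet> g = (g - h) \<bullet> h" by metis
  then have "(g - h) \<bullet> (g - h) = 0" by (simp add: inner_diff_right)
  then show ?thesis by simp
qed

text \<open>In finite dimension the values of the derivative on the basis form the representing
  vector; with uniqueness, the description operator in \<open>gradient\<close> denotes it.\<close>

lemma GDERIV_gradient: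
  fixes F :: "'a::euclidean_space \<Rightarrow> real"
  assumes "F differentiable (at x)"
  shows "GDERIV F x :> gradient F x"
proof -
  obtain f' where f': "(F has_derivative f') (at x)"
    using assms by (auto simp: differentiable_def)
  interpret f': linear f' by (rule has_derivative_linear[OF f'])
  have "f' h = h \<bullet> (\<Sum>b\<in>Basis. f' b *\<^sub>R b)" for h
  proof -
    have "f' h = f' (\<Sum>b\<in>Basis. (h \<bullet> b) *\<^sub>R b)" by (simp add: euclidean_representation)
    also have "\<dots> = (\<Sum>b\<in>Basis. (h \<bullet> b) * f' b)" by (simp add: f'.sum f'.scaleR)
    finally show ?thesis by (simp add: inner_sum_right mult.commute)
  qed
  then have "f' = (\<lambda>h. h \<bullet> (\<Sum>b\<in>Basis. f' b *\<^sub>R b))" by blast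
  then have g: "GDERIV F x :> (\<Sum>b\<in>Basis. f' b *\<^sub>R b)"
    using f' unfolding gderiv_def by simp
  show ?thesis
    unfolding gradient_def by (rule theI[where P = "\<lambda>g. GDERIV F x :> g", OF g]) (rule GDERIV_unique[OF _ g])
qed

text \<open>Monotonicity of \<open>h\<close> along the segment takes the place of integrating the
  gradient: Cauchy-Schwarz and the Lipschitz bound make its derivative nonpositive.\<close>

lemma L_smooth_descent:
  fixes F :: "'a::euclidean_space \<Rightarrow> real"
  assumes "L_smooth L F"
  shows "F (x + d) \<le> F x + gradient F x \<bullet> d + L / 2 * (norm d)\<^sup>2"
proof -
  define h where "h = (\<lambda>t. F (x + t *\<^sub>R d) - t * (gradient F x \<bullet> d) - L * t\<^sup>2 / 2 * (norm d)\<^sup>2)"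
  have "h 1 \<le> h 0"
  proof (rule DERIV_nonpos_imp_nonincreasing[of 0 1 h])
    fix t :: real assume t: "0 \<le> t" "t \<le> 1"
    have F: "(F has_derivative (\<lambda>v. v \<bullet> gradient F (x + t *\<^sub>R d))) (at (x + t *\<^sub>R d))"
      using GDERIV_gradient[of F] assms by (auto simp: L_smooth_def gderiv_def)
    have "((\<lambda>t. x + t *\<^sub>R d) has_derivative (\<lambda>u. u *\<^sub>R d)) (at t)"
      by (auto intro!: derivative_eq_intros)
    from has_derivative_compose[OF this F]
    have "((\<lambda>t. F (x + t *\<^sub>R d)) has_real_derivative gradient F (x + t *\<^sub>R d) \<bullet> d) (at t)"
      unfolding has_field_derivative_def
      by (rule has_derivative_eq_rhs) (simp add: fun_eq_iff inner_commute)
    then have "(h has_real_derivative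
        (gradient F (x + t *\<^sub>R d) - gradient F x) \<bullet> d - L * t * (norm d)\<^sup>2) (at t)"
      unfolding h_def by (auto intro!: derivative_eq_intros simp: inner_diff_left)
    moreover have "(gradient F (x + t *\<^sub>R d) - gradient F x) \<bullet> d \<le> L * t * (norm d)\<^sup>2"
    proof -
      have "(gradient F (x + t *\<^sub>R d) - gradient F x) \<bullet> d
          \<le> norm (gradient F (x + t *\<^sub>R d) - gradient F x) * norm d"
        by (rule norm_cauchy_schwarz)
      also have "\<dots> \<le> L * norm (x + t *\<^sub>R d - x) * norm d"
        using assms unfolding L_smooth_def by (intro mult_right_mono) (blast, simp)
      finally show ?thesis using t by (simp add: power2_eq_square mult.assoc)
    qed
    ultimately show "\<exists>y. (h has_real_derivative y) (at t) \<and> y \<le> 0" by fastforce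
  qed simp
  then show ?thesis by (simp add: h_def)
qed

text \<open>A gradient step of size \<open>1 / L\<close> lowers \<open>F\<close> by at least
  \<open>(norm (gradient F x))\<^sup>2 / (2 * L)\<close>, yet not below \<open>m\<close>.\<close>

lemma L_smooth_gradient_bound:
  fixes F :: "'a::euclidean_space \<Rightarrow> real"
  assumes "L_smooth L F" "0 < L" "\<And>y. m \<le> F y"
  shows "(norm (gradient F x))\<^sup>2 \<le> 2 * L * (F x - m)"
proof -
  let ?g = "gradient F x"
  have "m \<le> F (x + (- (1 / L)) *\<^sub>R ?g)" by (rule assms)
  also have "\<dots> \<le> F x + ?g \<bullet> ((- (1 / L)) *\<^sub>R ?g) + L / 2 * (norm ((- (1 / L)) *\<^sub>R ?g))\<^sup>2"
    by (rule L_smooth_descent) fact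
  also have "\<dots> = F x - (norm ?g)\<^sup>2 / (2 * L)"
    using assms(2) by (simp add: power2_norm_eq_inner[symmetric] field_simps power2_eq_square)
  finally show ?thesis using assms(2) by (simp add: field_simps)
qed

lemma L_smooth_measurable_gradient:
  fixes F :: "'a::euclidean_space \<Rightarrow> real"
  assumes "L_smooth L F"
  shows "gradient F \<in> borel_measurable borel"
proof (rule borel_measurable_continuous_onI, rule lipschitz_on_continuous_on)
  \<comment> \<open>\<open>lipschitz_on\<close> asks for a nonnegative constant, and the sign of
    \<open>L\<close> is not fixed here.\<close>
  show "(max L 0)-lipschitz_on UNIV (gradient F)"
    using assms by (auto simp: lipschitz_on_def L_smooth_def dist_norm
      intro: order.trans[OF _ mult_right_mono[OF max.cobounded1]])
qed

text \<open>For \<open>g \<noteq> 0\<close>,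
  \<open>a \<bullet> sgn g = norm g - (g - a) \<bullet> sgn g\<close> and
  \<open>norm g \<ge> norm a - norm (g - a)\<close>, so the error is paid twice. For
  \<open>g = 0\<close> the left side is \<open>- norm a\<close>.\<close>

lemma inner_sgn_ge:
  fixes a g :: "'a::real_inner"
  shows "norm a - 2 * norm (g - a) \<le> a \<bullet> sgn g"
proof (cases "g = 0")
  case False
  have "norm g = g \<bullet> sgn g" using False
    by (simp add: sgn_div_norm power2_norm_eq_inner[symmetric] power2_eq_square)
  moreover have "(g - a) \<bullet> sgn g \<le> norm (g - a) * norm (sgn g)" by (rule norm_cauchy_schwarz)
  ultimately show ?thesis
    using False norm_triangle_sub[of a g]
    by (simp add: norm_sgn inner_diff_left norm_minus_commute)
qed simp

subsection \<open>The stochastic process\<close>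

lemma minibatch_gradient_cong:
  assumes "\<And>j. 1 \<le> j \<Longrightarrow> j \<le> B t \<Longrightarrow> \<xi> t j \<omega> = \<xi>' t j \<omega>'"
  shows "minibatch_gradient G B \<xi> t x \<omega> = minibatch_gradient G B \<xi>' t x \<omega>'"
proof -
  have "(\<Sum>j=1..B t. G x (\<xi> t j \<omega>)) = (\<Sum>j=1..B t. G x (\<xi>' t j \<omega>'))"
    using assms by (intro sum.cong refl) simp
  then show ?thesis by (simp add: minibatch_gradient_def)
qed

text \<open>Row \<open>t\<close> of the noise first enters iterate \<open>Suc t\<close>. The two
  sides may live on different sample spaces, which allows passing from \<open>M\<close> to noise
  tables and back.\<close>

lemma minibatch_nsgd_cong:
  assumes "\<And>s j. 1 \<le> s \<Longrightarrow> s < t \<Longrightarrow> 1 \<le> j \<Longrightarrow> j \<le> B s \<Longrightarrow> \<xi> s j \<omega> = \<xi>' s j \<omega>'"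
  shows "minibatch_nsgd G x1 \<eta> B \<xi> t \<omega> = minibatch_nsgd G x1 \<eta> B \<xi>' t \<omega>'"
  using assms
proof (induction t)
  case (Suc t)
  show ?case
  proof (cases "t = 0")
    case False
    have "minibatch_nsgd G x1 \<eta> B \<xi> t \<omega> = minibatch_nsgd G x1 \<eta> B \<xi>' t \<omega>'"
      using Suc.prems by (intro Suc.IH) auto
    moreover have "minibatch_gradient G B \<xi> t x \<omega> = minibatch_gradient G B \<xi>' t x \<omega>'" for x
      using Suc.prems False by (intro minibatch_gradient_cong) auto
    ultimately show ?thesis by simp
  qed simp
qed simp

text \<open>Point and noise have separate arguments \<open>X\<close> and \<open>Y\<close>, so that
  on a product space they can come from different factors.\<close>

lemma measurable_minibatch_gradient:
  fixes G :: "'a::euclidean_space \<Rightarrow> 's \<Rightarrow> 'a"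
  assumes "(\<lambda>(x, s). G x s) \<in> borel_measurable (borel \<Otimes>\<^sub>M D)"
    and "X \<in> borel_measurable M" and "\<And>j. 1 \<le> j \<Longrightarrow> j \<le> B t \<Longrightarrow> (\<lambda>\<omega>. \<xi> t j (Y \<omega>)) \<in> M \<rightarrow>\<^sub>M D"
  shows "(\<lambda>\<omega>. minibatch_gradient G B \<xi> t (X \<omega>) (Y \<omega>)) \<in> borel_measurable M"
proof -
  have "(\<lambda>\<omega>. G (X \<omega>) (\<xi> t j (Y \<omega>))) \<in> borel_measurable M" if "1 \<le> j" "j \<le> B t" for j
    using measurable_compose[OF measurable_Pair[OF assms(2) assms(3)[OF that]] assms(1)]
    by simp
  then show ?thesis
    unfolding minibatch_gradient_def
    by (intro borel_measurable_scaleR borel_measurable_sum borel_measurable_const) auto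
qed

lemma measurable_sgn_vector [measurable]:
  "(sgn :: 'a::euclidean_space \<Rightarrow> 'a) \<in> borel_measurable borel"
  unfolding sgn_div_norm[abs_def] by measurable

lemma measurable_minibatch_nsgd:
  fixes G :: "'a::euclidean_space \<Rightarrow> 's \<Rightarrow> 'a"
  assumes G: "(\<lambda>(x, s). G x s) \<in> borel_measurable (borel \<Otimes>\<^sub>M D)"
    and "\<And>s j. 1 \<le> s \<Longrightarrow> s < t \<Longrightarrow> 1 \<le> j \<Longrightarrow> j \<le> B s \<Longrightarrow> \<xi> s j \<in> M \<rightarrow>\<^sub>M D"
  shows "minibatch_nsgd G x1 \<eta> B \<xi> t \<in> borel_measurable M"
  using assms(2)
proof (induction t)
  case (Suc t)
  show ?case
  proof (cases "t = 0")
    case False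
    have [measurable]: "minibatch_nsgd G x1 \<eta> B \<xi> t \<in> borel_measurable M"
      using Suc.prems by (intro Suc.IH) auto
    have [measurable]: "(\<lambda>\<omega>. minibatch_gradient G B \<xi> t (minibatch_nsgd G x1 \<eta> B \<xi> t \<omega>) \<omega>)
        \<in> borel_measurable M"
      using Suc.prems False by (intro measurable_minibatch_gradient[OF G]) auto
    show ?thesis
      unfolding minibatch_nsgd.simps using False by simp
  qed simp
next
  case 0
  have "minibatch_nsgd G x1 \<eta> B \<xi> 0 = (\<lambda>_. x1)" by (simp add: fun_eq_iff)
  then show ?case by simp
qed

section \<open>Exponential moments along the trajectory\<close>

text \<open>Tonelli in the role of conditioning on the past: with \<open>X\<close> frozen at
  \<open>x\<close>, the new factor integrates to at most \<open>1\<close>.\<close>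

lemma (in prob_space) nn_integral_indep_var_mult_le:
  fixes f :: "'b \<Rightarrow> ennreal" and g :: "'b \<times> 'b \<Rightarrow> ennreal"
  assumes indep: "indep_var S X N Y"
    and f[measurable]: "f \<in> borel_measurable S" and g[measurable]: "g \<in> borel_measurable (S \<Otimes>\<^sub>M N)"
    and le: "\<And>x. x \<in> space S \<Longrightarrow> (\<integral>\<^sup>+\<omega>. g (x, Y \<omega>) \<partial>M) \<le> 1"
  shows "(\<integral>\<^sup>+\<omega>. f (X \<omega>) * g (X \<omega>, Y \<omega>) \<partial>M) \<le> (\<integral>\<^sup>+\<omega>. f (X \<omega>) \<partial>M)"
proof -
  have X[measurable]: "X \<in> M \<rightarrow>\<^sub>M S" and Y[measurable]: "Y \<in> M \<rightarrow>\<^sub>M N"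
    and distr: "distr M S X \<Otimes>\<^sub>M distr M N Y = distr M (S \<Otimes>\<^sub>M N) (\<lambda>\<omega>. (X \<omega>, Y \<omega>))"
    using indep by (auto simp: indep_var_distribution_eq)
  interpret Y: prob_space "distr M N Y" by (rule prob_space_distr) fact
  have "(\<integral>\<^sup>+\<omega>. f (X \<omega>) * g (X \<omega>, Y \<omega>) \<partial>M)
      = (\<integral>\<^sup>+z. f (fst z) * g z \<partial>distr M (S \<Otimes>\<^sub>M N) (\<lambda>\<omega>. (X \<omega>, Y \<omega>)))"
    by (subst nn_integral_distr) auto
  also have "\<dots> = (\<integral>\<^sup>+x. \<integral>\<^sup>+y. f x * g (x, y) \<partial>distr M N Y \<partial>distr M S X)"
    unfolding distr[symmetric] by (subst Y.nn_integral_fst[symmetric]) auto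
  also have "\<dots> \<le> (\<integral>\<^sup>+x. f x \<partial>distr M S X)"
  proof (rule nn_integral_mono)
    fix x assume "x \<in> space (distr M S X)"
    then have x[measurable]: "x \<in> space S" by simp
    have "(\<integral>\<^sup>+y. f x * g (x, y) \<partial>distr M N Y) = f x * (\<integral>\<^sup>+\<omega>. g (x, Y \<omega>) \<partial>M)"
      by (simp add: nn_integral_distr nn_integral_cmult)
    also have "\<dots> \<le> f x * 1" using le[OF x] by (intro mult_left_mono) auto
    finally show "(\<integral>\<^sup>+y. f x * g (x, y) \<partial>distr M N Y) \<le> f x" by simp
  qed
  also have "\<dots> = (\<integral>\<^sup>+\<omega>. f (X \<omega>) \<partial>M)" by (simp add: nn_integral_distr)
  finally show ?thesis .
qed

text \<open>
  Past and present noise become independent by evaluating the iteration on the space of noise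
  tables \<open>h :: nat \<times> nat \<Rightarrow> 's\<close>, restricted to disjoint sets of indices: iterate \<open>t\<close> reads only rows
  below \<open>t\<close>, the minibatch gradient only row \<open>t\<close>.
\<close>

lemma nn_integral_exp_nsgd_le_1:
  fixes G :: "'a::euclidean_space \<Rightarrow> 's \<Rightarrow> 'a" and e :: "'a \<Rightarrow> 'a \<Rightarrow> real"
    and M :: "'w measure"
  assumes G: "(\<lambda>(x, s). G x s) \<in> borel_measurable (borel \<Otimes>\<^sub>M D)"
    and \<xi>: "independent_copies M D T B \<xi>"
    and e: "(\<lambda>(x, g). e x g) \<in> borel_measurable (borel \<Otimes>\<^sub>M borel)"
    and le: "\<And>t x. 1 \<le> t \<Longrightarrow> t \<le> T \<Longrightarrow>
      (\<integral>\<^sup>+\<omega>. exp (e x (minibatch_gradient G B \<xi> t x \<omega>)) \<partial>M) \<le> 1"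
  shows "(\<integral>\<^sup>+\<omega>. exp (\<Sum>t=1..T. e (minibatch_nsgd G x1 \<eta> B \<xi> t \<omega>)
      (minibatch_gradient G B \<xi> t (minibatch_nsgd G x1 \<eta> B \<xi> t \<omega>) \<omega>)) \<partial>M) \<le> 1"
proof -
  interpret prob_space M using \<xi> by (simp add: independent_copies_def)
  let ?I = "SIGMA t:{1..T}. {1..B t}"
  have indep: "indep_vars (\<lambda>_. D) (\<lambda>(t, j). \<xi> t j) ?I"
    using \<xi> by (simp add: independent_copies_def)
  define c :: "nat \<Rightarrow> nat \<Rightarrow> (nat \<times> nat \<Rightarrow> 's) \<Rightarrow> 's" where "c = (\<lambda>t j h. h (t, j))"
  define W where "W = (\<lambda>t h. \<Sum>s=1..t. e (minibatch_nsgd G x1 \<eta> B c s h)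
      (minibatch_gradient G B c s (minibatch_nsgd G x1 \<eta> B c s h) h))"
  define W' where "W' = (\<lambda>t \<omega>. \<Sum>s=1..t. e (minibatch_nsgd G x1 \<eta> B \<xi> s \<omega>)
      (minibatch_gradient G B \<xi> s (minibatch_nsgd G x1 \<eta> B \<xi> s \<omega>) \<omega>))"
  have "t \<le> T \<Longrightarrow> (\<integral>\<^sup>+\<omega>. exp (W' t \<omega>) \<partial>M) \<le> 1" for t
  proof (induction t)
    case 0
    then show ?case by (simp add: W'_def emeasure_space_1)
  next
    case (Suc t)
    let ?t = "Suc t"
    \<comment> \<open>\<open>A\<close> indexes the rows read by the iterates up to
      \<open>Suc t\<close>, \<open>A'\<close> the row of the new minibatch; disjointness makes
      \<open>H\<close> and \<open>N\<close> independent.\<close>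
    define A where "A = (SIGMA s:{1..t}. {1..B s})"
    define A' where "A' = {?t} \<times> {1..B ?t}"
    define H where "H = (\<lambda>\<omega>. restrict (\<lambda>i. case_prod \<xi> i \<omega>) A)"
    define N where "N = (\<lambda>\<omega>. restrict (\<lambda>i. case_prod \<xi> i \<omega>) A')"
    let ?X = "minibatch_nsgd G x1 \<eta> B c ?t"
    have HN: "indep_var (PiM A (\<lambda>_. D)) H (PiM A' (\<lambda>_. D)) N"
      unfolding H_def N_def
      by (rule indep_var_restrict[OF indep]) (use Suc.prems in \<open>auto simp: A_def A'_def\<close>)
    have cA: "c s j \<in> PiM A (\<lambda>_. D) \<rightarrow>\<^sub>M D" if "1 \<le> s" "s \<le> t" "1 \<le> j" "j \<le> B s" for s j
      unfolding c_def by (rule measurable_component_singleton) (use that in \<open>auto simp: A_def\<close>)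
    have cA': "c ?t j \<in> PiM A' (\<lambda>_. D) \<rightarrow>\<^sub>M D" if "1 \<le> j" "j \<le> B ?t" for j
      unfolding c_def by (rule measurable_component_singleton) (use that in \<open>auto simp: A'_def\<close>)
    have X[measurable]: "minibatch_nsgd G x1 \<eta> B c s \<in> borel_measurable (PiM A (\<lambda>_. D))" if "s \<le> ?t" for s
      by (rule measurable_minibatch_nsgd[OF G]) (use that cA in auto)
    have W: "W t \<in> borel_measurable (PiM A (\<lambda>_. D))"
      unfolding W_def
    proof (rule borel_measurable_sum)
      fix s assume s: "s \<in> {1..t}"
      have "(\<lambda>h. minibatch_gradient G B c s (minibatch_nsgd G x1 \<eta> B c s h) h)
          \<in> borel_measurable (PiM A (\<lambda>_. D))"
        by (rule measurable_minibatch_gradient[OF G X]) (use s cA in auto)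
      from measurable_compose[OF measurable_Pair[OF X this] e] s
      show "(\<lambda>h. e (minibatch_nsgd G x1 \<eta> B c s h)
          (minibatch_gradient G B c s (minibatch_nsgd G x1 \<eta> B c s h) h)) \<in> borel_measurable (PiM A (\<lambda>_. D))"
        by simp
    qed
    have X': "(\<lambda>z. ?X (fst z)) \<in> borel_measurable (PiM A (\<lambda>_. D) \<Otimes>\<^sub>M PiM A' (\<lambda>_. D))"
      by (rule measurable_compose[OF measurable_fst X]) simp
    have g: "(\<lambda>z. e (?X (fst z)) (minibatch_gradient G B c ?t (?X (fst z)) (snd z)))
        \<in> borel_measurable (PiM A (\<lambda>_. D) \<Otimes>\<^sub>M PiM A' (\<lambda>_. D))"
    proof -
      have "(\<lambda>z. minibatch_gradient G B c ?t (?X (fst z)) (snd z))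
          \<in> borel_measurable (PiM A (\<lambda>_. D) \<Otimes>\<^sub>M PiM A' (\<lambda>_. D))"
        by (rule measurable_minibatch_gradient[OF G X'])
          (rule measurable_compose[OF measurable_snd cA'])
      from measurable_compose[OF measurable_Pair[OF X' this] e]
      show ?thesis by simp
    qed
    have XH: "minibatch_nsgd G x1 \<eta> B c s (H \<omega>) = minibatch_nsgd G x1 \<eta> B \<xi> s \<omega>" if "s \<le> ?t" for s \<omega>
      by (rule minibatch_nsgd_cong) (use that in \<open>auto simp: c_def H_def A_def\<close>)
    have gH: "minibatch_gradient G B c s x (H \<omega>) = minibatch_gradient G B \<xi> s x \<omega>"
      if "1 \<le> s" "s \<le> t" for s x \<omega>
      by (rule minibatch_gradient_cong) (use that in \<open>auto simp: c_def H_def A_def\<close>)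
    have gN: "minibatch_gradient G B c ?t x (N \<omega>) = minibatch_gradient G B \<xi> ?t x \<omega>" for x \<omega>
      by (rule minibatch_gradient_cong) (auto simp: c_def N_def A'_def)
    have WH: "W t (H \<omega>) = W' t \<omega>" for \<omega>
      unfolding W_def W'_def by (intro sum.cong refl) (simp add: XH gH)
    \<comment> \<open>The last summand of \<open>W'\<close> becomes a separate factor. The iterate
      at \<open>Suc t\<close> stays folded, since it is a function of \<open>H\<close>
      alone.\<close>
    have "(\<integral>\<^sup>+\<omega>. exp (W' ?t \<omega>) \<partial>M) = (\<integral>\<^sup>+\<omega>. ennreal (exp (W t (H \<omega>))) *
        ennreal (exp (e (?X (fst (H \<omega>, N \<omega>)))
          (minibatch_gradient G B c ?t (?X (fst (H \<omega>, N \<omega>))) (snd (H \<omega>, N \<omega>))))) \<partial>M)"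
      unfolding WH by (intro nn_integral_cong)
        (simp add: W'_def XH gN ennreal_mult[symmetric] exp_add[symmetric] del: minibatch_nsgd.simps)
    also have "\<dots> \<le> (\<integral>\<^sup>+\<omega>. exp (W t (H \<omega>)) \<partial>M)"
    proof (rule nn_integral_indep_var_mult_le[OF HN])
      show "(\<lambda>h. ennreal (exp (W t h))) \<in> borel_measurable (PiM A (\<lambda>_. D))"
        using W by measurable
      show "(\<lambda>z. ennreal (exp (e (?X (fst z)) (minibatch_gradient G B c ?t (?X (fst z)) (snd z)))))
          \<in> borel_measurable (PiM A (\<lambda>_. D) \<Otimes>\<^sub>M PiM A' (\<lambda>_. D))"
        using g by measurable
      show "(\<integral>\<^sup>+\<omega>. ennreal (exp (e (?X (fst (h, N \<omega>)))
          (minibatch_gradient G B c ?t (?X (fst (h, N \<omega>))) (snd (h, N \<omega>))))) \<partial>M) \<le> 1" for h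
        using le[of ?t "?X h"] Suc.prems by (simp add: gN del: minibatch_nsgd.simps)
    qed
    also have "\<dots> \<le> 1"
      unfolding WH using Suc by simp
    finally show ?case .
  qed
  then show ?thesis by (simp add: W'_def)
qed

text \<open>\<open>f\<close> ranges over an interval of length \<open>2 * norm a\<close>, so
  Hoeffding's lemma yields the exponent \<open>l\<^sup>2 * (2 * norm a)\<^sup>2 / 8\<close>, which
  the quadratic term cancels. By \<open>inner_sgn_ge\<close> the mean of \<open>f\<close> is at most
  \<open>2 * \<nu> - norm a\<close>.\<close>

lemma (in prob_space) nn_integral_exp_sgn_le_1:
  fixes Y :: "'a \<Rightarrow> 'b::euclidean_space" and a :: 'b
  assumes l: "0 < l" and Y: "integrable M Y" and \<nu>: "expectation (\<lambda>\<omega>. norm (Y \<omega> - a)) \<le> \<nu>"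
  shows "(\<integral>\<^sup>+\<omega>. exp (l * (norm a - a \<bullet> sgn (Y \<omega>) - l / 2 * (norm a)\<^sup>2 - 2 * \<nu>)) \<partial>M) \<le> 1"
proof -
  have [measurable]: "Y \<in> borel_measurable M" using Y by simp
  define f where "f = (\<lambda>\<omega>. - (a \<bullet> sgn (Y \<omega>)))"
  have bound: "\<bar>f \<omega>\<bar> \<le> norm a" for \<omega>
  proof -
    have "\<bar>f \<omega>\<bar> \<le> norm a * norm (sgn (Y \<omega>))"
      unfolding f_def using Cauchy_Schwarz_ineq2[of a "sgn (Y \<omega>)"] by simp
    also have "\<dots> \<le> norm a * 1" by (intro mult_left_mono) (auto simp: norm_sgn)
    finally show ?thesis by simp
  qed
  interpret f: interval_bounded_random_variable M f "- norm a" "norm a"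
  proof
    show "f \<in> borel_measurable M" unfolding f_def by measurable
    show "AE \<omega> in M. f \<omega> \<in> {- norm a..norm a}"
      using bound by (intro AE_I2) (auto simp: abs_le_iff minus_le_iff)
  qed
  have "expectation f \<le> expectation (\<lambda>\<omega>. 2 * norm (Y \<omega> - a) - norm a)"
  proof (rule integral_mono)
    show "f \<omega> \<le> 2 * norm (Y \<omega> - a) - norm a" for \<omega>
      using inner_sgn_ge[of a "Y \<omega>"] by (simp add: f_def)
  qed (use Y f.integrable in auto)
  also have "\<dots> = 2 * expectation (\<lambda>\<omega>. norm (Y \<omega> - a)) - norm a"
    using Y by (simp add: prob_space)
  finally have Ef: "expectation f \<le> 2 * \<nu> - norm a" using \<nu> by simp
  have "l * (norm a - a \<bullet> sgn (Y \<omega>) - l / 2 * (norm a)\<^sup>2 - 2 * \<nu>)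
      \<le> l * (f \<omega> - expectation f) - l\<^sup>2 * (norm a)\<^sup>2 / 2" for \<omega>
  proof -
    have "l * (norm a - a \<bullet> sgn (Y \<omega>) - 2 * \<nu>) \<le> l * (f \<omega> - expectation f)"
      using l Ef by (intro mult_left_mono) (auto simp: f_def)
    then show ?thesis by (simp add: power2_eq_square algebra_simps)
  qed
  then have "(\<integral>\<^sup>+\<omega>. exp (l * (norm a - a \<bullet> sgn (Y \<omega>) - l / 2 * (norm a)\<^sup>2 - 2 * \<nu>)) \<partial>M)
      \<le> (\<integral>\<^sup>+\<omega>. ennreal (exp (- (l\<^sup>2 * (norm a)\<^sup>2 / 2))) * ennreal (exp (l * (f \<omega> - expectation f))) \<partial>M)"
    by (intro nn_integral_mono) (simp add: ennreal_mult[symmetric] exp_add[symmetric])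
  also have "\<dots> = ennreal (exp (- (l\<^sup>2 * (norm a)\<^sup>2 / 2)))
      * (\<integral>\<^sup>+\<omega>. ennreal (exp (l * (f \<omega> - expectation f))) \<partial>M)"
    by (rule nn_integral_cmult) measurable
  also have "\<dots> \<le> ennreal (exp (- (l\<^sup>2 * (norm a)\<^sup>2 / 2))) * ennreal (exp (l\<^sup>2 * (norm a)\<^sup>2 / 2))"
    using f.Hoeffdings_lemma_nn_integral[OF l]
    by (intro mult_left_mono) (simp_all add: power2_eq_square algebra_simps)
  also have "\<dots> = 1" by (simp add: ennreal_mult[symmetric] exp_add[symmetric])
  finally show ?thesis .
qed

text \<open>At a deterministic point the calls of one row are i.i.d. with law \<open>D\<close>;
  their moments pass from \<open>D\<close> to \<open>M\<close> through the image measure.\<close>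

lemma expectation_norm_minibatch_error_le:
  fixes G :: "'a::euclidean_space \<Rightarrow> 's \<Rightarrow> 'a"
  assumes p: "1 < p" "p \<le> 2" and \<sigma>: "0 \<le> \<sigma>" and \<kappa>: "0 < \<kappa>"
    and BCM: "p_BCM p \<sigma> F D G" and \<xi>: "independent_copies M D T B \<xi>"
    and t: "1 \<le> t" "t \<le> T" and B: "0 < B t" "(\<sigma> / \<kappa>) powr (p / (p - 1)) \<le> real (B t)"
  shows "integrable M (minibatch_gradient G B \<xi> t x)"
    and "(\<integral>\<omega>. norm (minibatch_gradient G B \<xi> t x \<omega> - gradient F x) \<partial>M) \<le> 2 * \<kappa>"
proof -
  interpret prob_space M using \<xi> by (simp add: independent_copies_def)
  interpret D: prob_space D using BCM by (simp add: p_BCM_def)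
  let ?J = "{t} \<times> {1..B t}" and ?a = "gradient F x"
  have indep: "indep_vars (\<lambda>_. D) (\<lambda>(t, j). \<xi> t j) ?J"
    using \<xi> t unfolding independent_copies_def by (auto intro: indep_vars_subset)
  have rv[measurable]: "\<xi> t j \<in> M \<rightarrow>\<^sub>M D" if "j \<in> {1..B t}" for j
    using indep that by (auto simp: indep_vars_def)
  have distr: "distr M D (\<xi> t j) = D" if "j \<in> {1..B t}" for j
    using \<xi> t that by (simp add: independent_copies_def)
  have Gx[measurable]: "G x \<in> borel_measurable D" and G: "integrable D (G x)" "(\<integral>s. G x s \<partial>D) = ?a"
    "integrable D (\<lambda>s. norm (G x s - ?a) powr p)" "(\<integral>s. norm (G x s - ?a) powr p \<partial>D) \<le> \<sigma> powr p"
    using BCM by (auto simp: p_BCM_def)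
  define X where "X = (\<lambda>(t, j) \<omega>. G x (\<xi> t j \<omega>) - ?a)"
  have int: "integrable M (\<lambda>\<omega>. f (\<xi> t j \<omega>))" "(\<integral>\<omega>. f (\<xi> t j \<omega>) \<partial>M) = (\<integral>s. f s \<partial>D)"
    if "j \<in> {1..B t}" "integrable D f" for j and f :: "'s \<Rightarrow> 'c::euclidean_space"
    using that integrable_distr_eq[OF rv[OF that(1)], of f] integral_distr[OF rv[OF that(1)], of f]
    by (auto simp: distr)
  have card: "card ?J = B t" by (simp add: card_cartesian_product)
  have "expectation (\<lambda>\<omega>. norm ((1 / real (card ?J)) *\<^sub>R (\<Sum>i\<in>?J. X i \<omega>))) \<le> 2 * \<kappa>"
  proof (rule expectation_norm_sample_mean_le[OF p _ _ _ _ _ _ _ \<sigma> \<kappa>])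
    show "indep_vars (\<lambda>_. borel) X ?J"
      using indep_vars_compose2[OF indep, of "\<lambda>_ s. G x s - ?a" "\<lambda>_. borel"]
      by (simp add: X_def case_prod_unfold)
    show "(\<sigma> / \<kappa>) powr (p / (p - 1)) \<le> real (card ?J)" using B by (simp only: card)
    fix i assume "i \<in> ?J"
    then obtain j where j: "i = (t, j)" "j \<in> {1..B t}" by auto
    show "integrable M (X i)"
      using int(1)[OF j(2), of "\<lambda>s. G x s - ?a"] G by (simp add: X_def j)
    show "expectation (X i) = 0"
      using int(2)[OF j(2), of "\<lambda>s. G x s - ?a"] G by (simp add: X_def j D.prob_space)
    show "integrable M (\<lambda>\<omega>. norm (X i \<omega>) powr p)"
      using int(1)[OF j(2), of "\<lambda>s. norm (G x s - ?a) powr p"] G by (simp add: X_def j)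
    show "expectation (\<lambda>\<omega>. norm (X i \<omega>) powr p) \<le> \<sigma> powr p"
      using int(2)[OF j(2), of "\<lambda>s. norm (G x s - ?a) powr p"] G by (simp add: X_def j)
  qed (use B in auto)
  moreover have "minibatch_gradient G B \<xi> t x \<omega> - ?a = (1 / real (card ?J)) *\<^sub>R (\<Sum>i\<in>?J. X i \<omega>)" for \<omega>
  proof -
    have "(\<Sum>i\<in>?J. X i \<omega>) = (\<Sum>j=1..B t. G x (\<xi> t j \<omega>)) - real (B t) *\<^sub>R ?a"
    proof -
      have "(\<Sum>i\<in>?J. X i \<omega>) = (\<Sum>j=1..B t. X (t, j) \<omega>)"
        by (rule sum.reindex_bij_witness[of _ "\<lambda>j. (t, j)" snd]) auto
      then show ?thesis by (simp add: X_def sum_subtractf sum_constant_scaleR)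
    qed
    then show ?thesis
      unfolding card using B by (simp add: minibatch_gradient_def scaleR_diff_right)
  qed
  ultimately show "(\<integral>\<omega>. norm (minibatch_gradient G B \<xi> t x \<omega> - ?a) \<partial>M) \<le> 2 * \<kappa>" by simp
  show "integrable M (minibatch_gradient G B \<xi> t x)"
    unfolding minibatch_gradient_def[abs_def]
    by (intro integrable_scaleR_right Bochner_Integration.integrable_sum int G)
qed

section \<open>Pathwise bounds along the trajectory\<close>

lemma norm_minibatch_nsgd_diff_le:
  assumes "\<And>t. 0 \<le> \<eta> t"
  shows "norm (minibatch_nsgd G x1 \<eta> B \<xi> t \<omega> - x1) \<le> (\<Sum>s=1..<t. \<eta> s)"
proof (induction t)
  case (Suc t)
  show ?case
  proof (cases "t = 0")
    case False
    let ?x = "minibatch_nsgd G x1 \<eta> B \<xi> t \<omega>"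
    let ?g = "minibatch_gradient G B \<xi> t ?x \<omega>"
    have "norm (?x - \<eta> t *\<^sub>R sgn ?g - x1) \<le> norm (?x - x1) + norm (\<eta> t *\<^sub>R sgn ?g)"
      using norm_triangle_ineq4[of "?x - x1" "\<eta> t *\<^sub>R sgn ?g"] by (simp add: algebra_simps)
    also have "norm (\<eta> t *\<^sub>R sgn ?g) \<le> \<eta> t"
      using assms[of t] by (simp add: norm_sgn)
    also have "norm (?x - x1) + \<eta> t \<le> (\<Sum>s=1..<Suc t. \<eta> s)"
      using Suc.IH False by simp
    finally show ?thesis using False by simp
  qed simp
qed simp

text \<open>The descent lemma summed over the steps; the squared step length is
  \<open>\<eta>\<^sup>2\<close> or, for a vanishing minibatch gradient, \<open>0\<close>.\<close>

lemma L_smooth_nsgd_descent: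
  fixes F :: "'a::euclidean_space \<Rightarrow> real" and \<eta> :: real
  assumes L: "0 \<le> L" "L_smooth L F" and x: "x = (\<lambda>t. minibatch_nsgd G x1 (\<lambda>_. \<eta>) B \<xi> t \<omega>)"
  shows "F (x (Suc T)) \<le> F x1
    - \<eta> * (\<Sum>t=1..T. gradient F (x t) \<bullet> sgn (minibatch_gradient G B \<xi> t (x t) \<omega>))
    + real T * (L / 2 * \<eta>\<^sup>2)"
proof (induction T)
  case (Suc T)
  let ?t = "Suc T"
  let ?g = "minibatch_gradient G B \<xi> ?t (x ?t) \<omega>"
  \<comment> \<open>The index \<open>?t\<close> is at least \<open>1\<close>, so the recursion takes
    its update branch.\<close>
  have "x (Suc ?t) = x ?t + (- \<eta>) *\<^sub>R sgn ?g" by (simp add: x)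
  then have "F (x (Suc ?t)) \<le> F (x ?t) + gradient F (x ?t) \<bullet> ((- \<eta>) *\<^sub>R sgn ?g)
      + L / 2 * (norm ((- \<eta>) *\<^sub>R sgn ?g))\<^sup>2"
    using L_smooth_descent[OF L(2)] by metis
  also have "(norm ((- \<eta>) *\<^sub>R sgn ?g))\<^sup>2 \<le> \<eta>\<^sup>2" by (simp add: norm_sgn)
  also have "gradient F (x ?t) \<bullet> ((- \<eta>) *\<^sub>R sgn ?g) = - (\<eta> * (gradient F (x ?t) \<bullet> sgn ?g))" by simp
  finally have "F (x (Suc ?t)) \<le> F (x ?t) - \<eta> * (gradient F (x ?t) \<bullet> sgn ?g) + L / 2 * \<eta>\<^sup>2"
    using L(1) by (simp add: mult_left_mono)
  then show ?case
    using Suc by (simp add: field_simps)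
qed (simp add: x)

section \<open>The high-probability bound\<close>

text \<open>The threshold \<open>c\<close> is left free so that both the explicit rate and a target
  accuracy \<open>\<epsilon>\<close> can be inserted.\<close>

lemma nsgd_high_probability:
  fixes F :: "'a::euclidean_space \<Rightarrow> real" and M :: "'w measure"
  assumes lower: "\<And>x. F_star \<le> F x"
    and \<Delta>: "F x1 - F_star \<le> \<Delta>\<^sub>1" "0 < \<Delta>\<^sub>1"
    and L: "0 < L" "L_smooth L F"
    and p: "1 < p" "p \<le> 2" and \<sigma>: "0 \<le> \<sigma>" and BCM: "p_BCM p \<sigma> F D G"
    and \<delta>: "0 < \<delta>" "\<delta> < 1"
    and T: "1 \<le> T" and \<xi>: "independent_copies M D T (nsgd_batch p \<sigma> \<Delta>\<^sub>1 L T) \<xi>"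
    and c: "(11 + 30 * ln (1 / \<delta>)) * (sqrt (\<Delta>\<^sub>1 * L) / sqrt (real T)) \<le> c"
  shows "1 - \<delta> \<le> measure M {\<omega> \<in> space M.
    avg_gradient_norm F
      (minibatch_nsgd G x1 (nsgd_step \<Delta>\<^sub>1 L T) (nsgd_batch p \<sigma> \<Delta>\<^sub>1 L T) \<xi>) T \<omega> \<le> c}"
proof -
  define B where "B = nsgd_batch p \<sigma> \<Delta>\<^sub>1 L T"
  define \<eta> where "\<eta> = sqrt (\<Delta>\<^sub>1 / (L * real T))"
  define \<kappa> where "\<kappa> = sqrt (\<Delta>\<^sub>1 * L) / sqrt (real T)"
  \<comment> \<open>The reciprocal of the bound on the gradient norms along the trajectory, see
    \<open>n_le\<close>.\<close>
  define l where "l = 1 / (3 * \<kappa> * real T)"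
  define x where "x = (\<lambda>t \<omega>. minibatch_nsgd G x1 (\<lambda>_. \<eta>) B \<xi> t \<omega>)"
  define g where "g = (\<lambda>t \<omega>. minibatch_gradient G B \<xi> t (x t \<omega>) \<omega>)"
  \<comment> \<open>The last term is \<open>2 * \<nu>\<close> for the mean minibatch error
    \<open>\<nu> = 2 * \<kappa>\<close>.\<close>
  define e where "e = (\<lambda>x g. norm (gradient F x) - gradient F x \<bullet> sgn g
    - l / 2 * (norm (gradient F x))\<^sup>2 - 2 * (2 * \<kappa>))"
  define W where "W = (\<lambda>\<omega>. \<Sum>t=1..T. l * e (x t \<omega>) (g t \<omega>))"
  have step: "nsgd_step \<Delta>\<^sub>1 L T = (\<lambda>_. \<eta>)" by (simp add: nsgd_step_def \<eta>_def)
  have T0: "0 < real T" using T by simp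
  have \<kappa>: "0 < \<kappa>" using \<Delta> L T by (simp add: \<kappa>_def)
  have \<eta>: "0 < \<eta>" using \<Delta> L T by (simp add: \<eta>_def)
  have l: "0 < l" using \<kappa> T by (simp add: l_def)
  have sqr: "\<kappa>\<^sup>2 = \<Delta>\<^sub>1 * L / real T" "\<eta>\<^sup>2 = \<Delta>\<^sub>1 / (L * real T)"
    using \<Delta> L T by (simp_all add: \<kappa>_def \<eta>_def power_divide)
  \<comment> \<open>With these identities every later bound becomes a multiple of
    \<open>\<kappa> * real T\<close>.\<close>
  have "\<Delta>\<^sub>1 = \<eta> * (\<kappa> * real T)" and "L * \<eta> = \<kappa>"
  proof -
    have "(L * \<eta>)\<^sup>2 = \<kappa>\<^sup>2" unfolding power_mult_distrib sqr using L T by (simp add: power2_eq_square)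
    then show "L * \<eta> = \<kappa>" using L \<eta> \<kappa> by (simp add: power2_eq_iff_nonneg)
    then have "\<eta> * (\<kappa> * real T) = L * \<eta>\<^sup>2 * real T" by (simp add: power2_eq_square algebra_simps)
    then show "\<Delta>\<^sub>1 = \<eta> * (\<kappa> * real T)" using L T by (simp add: sqr)
  qed
  note \<Delta>_eq = this(1) and L_eq = this(2)
  interpret prob_space M using \<xi> by (simp add: independent_copies_def)
  have \<xi>': "independent_copies M D T B \<xi>" using \<xi> by (simp add: B_def)
  have G: "(\<lambda>(x, s). G x s) \<in> borel_measurable (borel \<Otimes>\<^sub>M D)" using BCM by (simp add: p_BCM_def)
  have rv: "\<xi> t j \<in> M \<rightarrow>\<^sub>M D" if "1 \<le> t" "t \<le> T" "1 \<le> j" "j \<le> B t" for t j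
    using \<xi>' that by (force simp: independent_copies_def indep_vars_def)
  have xm[measurable]: "x t \<in> borel_measurable M" if "t \<le> T" for t
    unfolding x_def by (rule measurable_minibatch_nsgd[OF G]) (use that rv in auto)
  have [measurable]: "g t \<in> borel_measurable M" if "1 \<le> t" "t \<le> T" for t
    unfolding g_def by (rule measurable_minibatch_gradient[OF G xm]) (use that rv in auto)
  have [measurable]: "gradient F \<in> borel_measurable borel"
    by (rule L_smooth_measurable_gradient[OF L(2)])
  have em[measurable]: "(\<lambda>(x, g). e x g) \<in> borel_measurable (borel \<Otimes>\<^sub>M borel)"
    unfolding e_def by measurable
  have Wm[measurable]: "W \<in> borel_measurable M"
    unfolding W_def
  proof (intro borel_measurable_sum borel_measurable_times borel_measurable_const)
    fix t assume "t \<in> {1..T}"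
    then have [measurable]: "x t \<in> borel_measurable M" "g t \<in> borel_measurable M" by simp_all
    show "(\<lambda>\<omega>. e (x t \<omega>) (g t \<omega>)) \<in> borel_measurable M"
      unfolding e_def by measurable
  qed
  have B: "0 < B t" "(\<sigma> / \<kappa>) powr (p / (p - 1)) \<le> real (B t)" for t
  proof -
    define b where "b = (\<sigma>\<^sup>2 * real T / (\<Delta>\<^sub>1 * L)) powr (p / (2 * p - 2))"
    have Bt: "B t = nat \<lceil>max 1 b\<rceil>" by (simp add: B_def nsgd_batch_def b_def)
    then show "0 < B t" by (simp add: less_le_trans[OF zero_less_one])
    \<comment> \<open>The base of the batch size is a square, which doubles the exponent
      \<open>p / (2 * p - 2)\<close> to \<open>p / (p - 1)\<close>.\<close>
    have "\<sigma>\<^sup>2 * real T / (\<Delta>\<^sub>1 * L) = (\<sigma> / \<kappa>)\<^sup>2" by (simp add: power_divide sqr)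
    then have "b = (\<sigma> / \<kappa>) powr (2 * (p / (2 * p - 2)))"
      using \<sigma> \<kappa> by (simp add: b_def powr_numeral[symmetric] powr_powr del: powr_numeral)
    also have "2 * (p / (2 * p - 2)) = p / (p - 1)" using p by (simp add: field_simps)
    finally show "(\<sigma> / \<kappa>) powr (p / (p - 1)) \<le> real (B t)"
      unfolding Bt by linarith
  qed
  have "(\<integral>\<^sup>+\<omega>. exp (W \<omega>) \<partial>M) \<le> 1"
    unfolding W_def g_def x_def
  proof (rule nn_integral_exp_nsgd_le_1[OF G \<xi>', of "\<lambda>x g. l * e x g"])
    show "(\<lambda>(x, g). l * e x g) \<in> borel_measurable (borel \<Otimes>\<^sub>M borel)"
      using borel_measurable_times[OF borel_measurable_const em, of l] by (simp add: case_prod_unfold)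
    show "(\<integral>\<^sup>+\<omega>. exp (l * e x (minibatch_gradient G B \<xi> t x \<omega>)) \<partial>M) \<le> 1"
      if "1 \<le> t" "t \<le> T" for t x
      unfolding e_def using l expectation_norm_minibatch_error_le[OF p \<sigma> \<kappa> BCM \<xi>' that B]
      by (intro nn_integral_exp_sgn_le_1) auto
  qed
  moreover have "(\<integral>\<^sup>+\<omega>. ennreal (exp (W \<omega>)) * indicator (space M) \<omega> \<partial>M) = (\<integral>\<^sup>+\<omega>. exp (W \<omega>) \<partial>M)"
    by (rule nn_integral_cong) simp
  \<comment> \<open>Markov's inequality for \<open>exp (W \<omega>)\<close> at level
    \<open>1 / \<delta>\<close>, multiplied out to avoid division in \<open>ennreal\<close>.\<close>
  ultimately have "ennreal \<delta> * (\<integral>\<^sup>+\<omega>. ennreal (exp (W \<omega>)) * indicator (space M) \<omega> \<partial>M)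
      \<le> ennreal \<delta> * 1"
    by (intro mult_left_mono) simp_all
  moreover have "emeasure M {\<omega> \<in> space M. 1 \<le> ennreal \<delta> * ennreal (exp (W \<omega>))}
      \<le> ennreal \<delta> * (\<integral>\<^sup>+\<omega>. ennreal (exp (W \<omega>)) * indicator (space M) \<omega> \<partial>M)"
    by (rule nn_integral_Markov_inequality) auto
  ultimately have "emeasure M {\<omega> \<in> space M. 1 \<le> ennreal \<delta> * ennreal (exp (W \<omega>))} \<le> \<delta>"
    by simp
  also have "{\<omega> \<in> space M. 1 \<le> ennreal \<delta> * ennreal (exp (W \<omega>))} = {\<omega> \<in> space M. ln (1 / \<delta>) \<le> W \<omega>}"
  proof (intro Collect_cong conj_cong refl)
    fix \<omega>
    have "ln (1 / \<delta>) \<le> W \<omega> \<longleftrightarrow> exp (ln (1 / \<delta>)) \<le> exp (W \<omega>)" by (simp only: exp_le_cancel_iff)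
    also have "\<dots> \<longleftrightarrow> 1 \<le> \<delta> * exp (W \<omega>)"
      using \<delta> by (simp add: divide_le_eq mult.commute)
    also have "\<dots> \<longleftrightarrow> 1 \<le> ennreal \<delta> * ennreal (exp (W \<omega>))"
      using \<delta> by (simp add: ennreal_mult[symmetric])
    finally show "1 \<le> ennreal \<delta> * ennreal (exp (W \<omega>)) \<longleftrightarrow> ln (1 / \<delta>) \<le> W \<omega>" ..
  qed
  finally have "prob {\<omega> \<in> space M. ln (1 / \<delta>) \<le> W \<omega>} \<le> \<delta>"
    using \<delta> by (simp add: emeasure_eq_measure)
  moreover have "prob (space M - {\<omega> \<in> space M. ln (1 / \<delta>) \<le> W \<omega>})
      = 1 - prob {\<omega> \<in> space M. ln (1 / \<delta>) \<le> W \<omega>}"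
    by (rule prob_compl) measurable
  \<comment> \<open>Off the Markov event the rest is a deterministic estimate for each
    outcome.\<close>
  moreover have "space M - {\<omega> \<in> space M. ln (1 / \<delta>) \<le> W \<omega>}
      \<subseteq> {\<omega> \<in> space M. avg_gradient_norm F x T \<omega> \<le> c}"
  proof clarsimp
    fix \<omega> assume "\<not> ln (1 / \<delta>) \<le> W \<omega>"
    define n where "n = (\<lambda>t. norm (gradient F (x t \<omega>)))"
    define \<phi> where "\<phi> = (\<lambda>t. gradient F (x t \<omega>) \<bullet> sgn (g t \<omega>))"
    \<comment> \<open>Drift from \<open>x1\<close> changes the gradient by at most
      \<open>L * (real T * \<eta>) = \<kappa> * real T\<close>; the initial gradient adds at most
      \<open>2 * \<kappa> * real T\<close>.\<close>
    have n_le: "l * n t \<le> 1" if "t \<in> {1..T}" for t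
    proof -
      have "norm (x t \<omega> - x1) \<le> (\<Sum>s=1..<t. \<eta>)"
        unfolding x_def by (rule norm_minibatch_nsgd_diff_le) (use \<eta> in simp)
      also have "\<dots> \<le> real T * \<eta>"
        using that \<eta> by (auto intro!: mult_right_mono)
      finally have "L * norm (x t \<omega> - x1) \<le> L * (real T * \<eta>)"
        using L by (intro mult_left_mono) auto
      also have "\<dots> = \<kappa> * real T" by (simp flip: L_eq)
      finally have "norm (gradient F (x t \<omega>) - gradient F x1) \<le> \<kappa> * real T"
        using L(2) unfolding L_smooth_def by (blast intro: order.trans)
      moreover have "norm (gradient F x1) \<le> 2 * \<kappa> * real T"
      proof (rule power2_le_imp_le)
        have "(norm (gradient F x1))\<^sup>2 \<le> 2 * L * (F x1 - F_star)"
          by (rule L_smooth_gradient_bound[OF L(2,1) lower])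
        also have "\<dots> \<le> 2 * L * \<Delta>\<^sub>1" using \<Delta> L by (intro mult_left_mono) auto
        also have "\<dots> = 2 * (\<kappa>\<^sup>2 * real T)" using T by (simp add: sqr)
        also have "\<dots> \<le> 4 * (\<kappa>\<^sup>2 * (real T)\<^sup>2)"
          using T by (intro mult_mono) (auto simp: power2_eq_square)
        finally show "(norm (gradient F x1))\<^sup>2 \<le> (2 * \<kappa> * real T)\<^sup>2"
          by (simp add: power_mult_distrib)
      qed (use \<kappa> in simp)
      ultimately have "n t \<le> 3 * \<kappa> * real T"
        unfolding n_def using norm_triangle_sub[of "gradient F (x t \<omega>)" "gradient F x1"] by linarith
      then show ?thesis using \<kappa> T by (simp add: l_def)
    qed
    have "W \<omega> = l * (\<Sum>t=1..T. e (x t \<omega>) (g t \<omega>))" by (simp add: W_def sum_distrib_left)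
    with \<open>\<not> ln (1 / \<delta>) \<le> W \<omega>\<close> have e_le: "(\<Sum>t=1..T. e (x t \<omega>) (g t \<omega>)) \<le> ln (1 / \<delta>) / l"
      using l by (simp add: field_simps)
    have "(\<Sum>t=1..T. n t / 2 - \<phi> t - 4 * \<kappa>) \<le> (\<Sum>t=1..T. e (x t \<omega>) (g t \<omega>))"
    proof (rule sum_mono)
      fix t assume "t \<in> {1..T}"
      then have "l * n t * n t \<le> 1 * n t" by (intro mult_right_mono n_le) (auto simp: n_def)
      then show "n t / 2 - \<phi> t - 4 * \<kappa> \<le> e (x t \<omega>) (g t \<omega>)"
        by (simp add: e_def n_def \<phi>_def power2_eq_square mult.assoc)
    qed
    then have "(\<Sum>t=1..T. n t) / 2 - (\<Sum>t=1..T. \<phi> t) - 4 * (\<kappa> * real T) \<le> ln (1 / \<delta>) / l"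
      using e_le by (simp add: sum_subtractf sum_divide_distrib mult_ac)
    \<comment> \<open>The initial gap over \<open>\<eta>\<close> contributes
      \<open>\<kappa> * real T\<close>, the smoothness term half of that.\<close>
    moreover have "(\<Sum>t=1..T. \<phi> t) \<le> 3 / 2 * (\<kappa> * real T)"
    proof -
      have "F_star \<le> F (x (Suc T) \<omega>)" by (rule lower)
      also have "\<dots> \<le> F x1 - \<eta> * (\<Sum>t=1..T. \<phi> t) + real T * (L / 2 * \<eta>\<^sup>2)"
        unfolding \<phi>_def g_def using L by (intro L_smooth_nsgd_descent) (auto simp: x_def)
      also have "real T * (L / 2 * \<eta>\<^sup>2) = \<eta> * (\<kappa> * real T) / 2"
        by (simp add: power2_eq_square flip: L_eq)
      finally have "\<eta> * (\<Sum>t=1..T. \<phi> t) \<le> \<eta> * (3 / 2 * (\<kappa> * real T))"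
        using \<Delta>(1) \<Delta>_eq by simp
      then show ?thesis using \<eta> by simp
    qed
    \<comment> \<open>Here \<open>11 = 2 * (4 + 3 / 2)\<close>. The logarithm acquires the factor
      \<open>2 * 3 = 6\<close>, then relaxed to \<open>30\<close> since
      \<open>ln (1 / \<delta>)\<close> is nonnegative.\<close>
    ultimately have "(\<Sum>t=1..T. n t) \<le> 11 * (\<kappa> * real T) + 2 * (ln (1 / \<delta>) / l)" by linarith
    also have "ln (1 / \<delta>) / l = 3 * ln (1 / \<delta>) * (\<kappa> * real T)" by (simp add: l_def)
    finally have "(\<Sum>t=1..T. n t) \<le> (11 + 6 * ln (1 / \<delta>)) * (\<kappa> * real T)" by (simp add: algebra_simps)
    also have "\<dots> \<le> (11 + 30 * ln (1 / \<delta>)) * (\<kappa> * real T)"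
      using \<kappa> T \<delta> by (intro mult_right_mono) (auto simp: ln_div)
    finally have "avg_gradient_norm F x T \<omega> \<le> (11 + 30 * ln (1 / \<delta>)) * \<kappa>"
      using T by (simp add: avg_gradient_norm_def n_def field_simps)
    then show "avg_gradient_norm F x T \<omega> \<le> c" using c by (simp add: \<kappa>_def)
  qed
  \<comment> \<open>Monotonicity requires the larger set to be measurable; \<open>measure\<close> is
    \<open>0\<close> on other sets.\<close>
  moreover have "{\<omega> \<in> space M. avg_gradient_norm F x T \<omega> \<le> c} \<in> events"
  proof -
    have "(\<lambda>\<omega>. \<Sum>t=1..T. norm (gradient F (x t \<omega>))) \<in> borel_measurable M"
      by (intro borel_measurable_sum) measurable
    then show ?thesis unfolding avg_gradient_norm_def by measurable
  qed
  ultimately have "1 - \<delta> \<le> prob {\<omega> \<in> space M. avg_gradient_norm F x T \<omega> \<le> c}"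
    using finite_measure_mono[of "space M - {\<omega> \<in> space M. ln (1 / \<delta>) \<le> W \<omega>}"
      "{\<omega> \<in> space M. avg_gradient_norm F x T \<omega> \<le> c}"] by linarith
  then show ?thesis
    by (simp add: step B_def x_def[abs_def])
qed

subsection \<open>Sample complexity\<close>

text \<open>The roundings in the horizon and in the batch size cost a factor \<open>2\<close> each,
  whence the \<open>4\<close>; \<open>11 + 30 * ln (1 / d)\<close> is at most
  \<open>30 * (1 + ln (1 / d))\<close>. The log power collects \<open>2\<close> from the horizon and
  \<open>q / (q - 1)\<close> from the batch size.\<close>

lemma oracle_calls_le:
  fixes q s \<Delta> L d \<epsilon> :: real
  assumes q: "1 < q" and d: "0 < d" "d < 1" and pos: "0 < \<Delta>" "0 < L" "0 \<le> s" "0 < \<epsilon>"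
    and small: "\<epsilon> < sqrt (\<Delta> * L)" and T: "T = nsgd_horizon \<Delta> L d \<epsilon>"
  shows "real (oracle_calls (nsgd_batch q s \<Delta> L T) T)
    \<le> (4 * 30\<^sup>2 * (sqrt 2 * 30) powr (q / (q - 1))) * (1 + ln (1 / d)) powr (2 + q / (q - 1)) *
       (\<Delta> * L / \<epsilon>\<^sup>2 + \<Delta> * L / \<epsilon>\<^sup>2 * (s / \<epsilon>) powr (q / (q - 1)))"
proof -
  define A where "A = \<Delta> * L / \<epsilon>\<^sup>2"
  define l where "l = 1 + ln (1 / d)"
  define e where "e = q / (q - 1)"
  \<comment> \<open>\<open>K\<^sup>2\<close> is the factor by which the horizon may exceed
    \<open>A\<close>. That \<open>K \<ge> 1\<close> lets \<open>K powr e\<close> also absorb the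
    constant \<open>1\<close> in \<open>1 + X\<close>.\<close>
  define K where "K = sqrt 2 * 30 * l"
  have l: "1 \<le> l" using d by (simp add: l_def)
  have e: "0 < e" using q by (simp add: e_def)
  have K: "1 \<le> K"
  proof -
    have "1 \<le> sqrt 2" by simp
    then have "1 * 1 \<le> (sqrt 2 * 30) * l" using l by (intro mult_mono) linarith+
    then show ?thesis by (simp add: K_def)
  qed
  \<comment> \<open>Smallness of \<open>\<epsilon>\<close> enters here; it makes the argument of the
    ceiling in the horizon at least \<open>1\<close>.\<close>
  have A: "1 \<le> A"
  proof -
    have "\<epsilon>\<^sup>2 \<le> (sqrt (\<Delta> * L))\<^sup>2" using small pos by (intro power_mono) auto
    then show ?thesis using pos by (simp add: A_def)
  qed
  have T_le: "real T \<le> 2 * (30 * l)\<^sup>2 * A"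
  proof -
    define h where "h = (11 + 30 * ln (1 / d))\<^sup>2"
    have "0 \<le> ln (1 / d)" using d by simp
    then have "1\<^sup>2 \<le> h" unfolding h_def by (intro power_mono) auto
    have h: "h \<le> (30 * l)\<^sup>2"
      unfolding h_def using \<open>0 \<le> ln (1 / d)\<close> by (intro power_mono) (auto simp: l_def)
    have hA: "1 \<le> h * A" using mult_mono[OF \<open>1\<^sup>2 \<le> h\<close> A] by (simp add: h_def)
    have "real T = real (nat \<lceil>h * A\<rceil>)" by (simp add: T nsgd_horizon_def h_def A_def)
    also have "\<dots> \<le> h * A + 1" using hA by linarith
    also have "\<dots> \<le> 2 * (h * A)" using hA by linarith
    also have "\<dots> \<le> 2 * ((30 * l)\<^sup>2 * A)" using h A by (intro mult_left_mono mult_right_mono) auto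
    finally show ?thesis by simp
  qed
  define X where "X = (s\<^sup>2 * real T / (\<Delta> * L)) powr (q / (2 * q - 2))"
  have X: "X \<le> (K * (s / \<epsilon>)) powr e"
  proof -
    have "s\<^sup>2 * real T / (\<Delta> * L) \<le> s\<^sup>2 * (2 * (30 * l)\<^sup>2 * A) / (\<Delta> * L)"
      using T_le pos by (intro divide_right_mono mult_left_mono) auto
    also have "\<dots> = (K * (s / \<epsilon>))\<^sup>2"
      using pos by (simp add: A_def K_def power_mult_distrib power_divide)
    finally have "X \<le> ((K * (s / \<epsilon>))\<^sup>2) powr (q / (2 * q - 2))"
      unfolding X_def using pos q by (intro powr_mono2) auto
    also have "\<dots> = (K * (s / \<epsilon>)) powr (2 * (q / (2 * q - 2)))"
      using pos K by (simp add: powr_numeral[symmetric] powr_powr del: powr_numeral)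
    also have "2 * (q / (2 * q - 2)) = e" using q by (simp add: e_def field_simps)
    finally show ?thesis .
  qed
  have "real (nat \<lceil>max 1 X\<rceil>) \<le> max 1 X + 1" by linarith
  also have "\<dots> \<le> 2 * (1 + X)" by (auto simp: X_def max_def)
  also have "\<dots> \<le> 2 * (K powr e + K powr e * (s / \<epsilon>) powr e)"
    using X K e pos ge_one_powr_ge_zero[of K e] by (simp add: powr_mult[symmetric])
  finally have B: "real (nat \<lceil>max 1 X\<rceil>) \<le> 2 * K powr e * (1 + (s / \<epsilon>) powr e)"
    by (simp add: algebra_simps)
  have "real (oracle_calls (nsgd_batch q s \<Delta> L T) T) = real T * real (nat \<lceil>max 1 X\<rceil>)"
    by (simp add: oracle_calls_def nsgd_batch_def X_def)
  also have "\<dots> \<le> (2 * (30 * l)\<^sup>2 * A) * (2 * K powr e * (1 + (s / \<epsilon>) powr e))"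
    using T_le B by (rule mult_mono) (use A in auto)
  also have "K powr e = (sqrt 2 * 30) powr e * l powr e"
    using l unfolding K_def by (intro powr_mult)
  also have "(2 * (30 * l)\<^sup>2 * A) * (2 * ((sqrt 2 * 30) powr e * l powr e) * (1 + (s / \<epsilon>) powr e))
     = (4 * 30\<^sup>2 * (sqrt 2 * 30) powr e) * (l\<^sup>2 * l powr e) * (A + A * (s / \<epsilon>) powr e)"
    by (simp add: power_mult_distrib algebra_simps)
  also have "l\<^sup>2 * l powr e = l powr (2 + e)"
    using l by (simp add: powr_add powr_numeral)
  finally show ?thesis by (simp only: A_def l_def e_def)
qed

text \<open>The complexity bound quantifies its parameters afresh, so that \<open>C\<close> and
  \<open>k\<close> can depend on the exponent only and the threshold only on
  \<open>\<Delta>\<close>, \<open>\<L>\<close> and \<open>s\<close>.\<close>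

theorem corollary5:
  fixes F :: "real^'d \<Rightarrow> real" and F_star \<Delta>\<^sub>1 L p \<sigma> \<delta> :: real
    and x1 :: "real^'d" and D :: "'s measure" and G :: "real^'d \<Rightarrow> 's \<Rightarrow> real^'d"
  assumes "\<forall>x. F_star \<le> F x"
    and "F x1 - F_star \<le> \<Delta>\<^sub>1" and "0 < \<Delta>\<^sub>1"
    and "0 < L" and "L_smooth L F"
    and "1 < p" and "p \<le> 2" and "0 \<le> \<sigma>" and "p_BCM p \<sigma> F D G"
    and "0 < \<delta>" and "\<delta> < 1"
  shows
    "(\<forall>T (M :: 'w measure) \<xi>.
        1 \<le> T \<longrightarrow> independent_copies M D T (nsgd_batch p \<sigma> \<Delta>\<^sub>1 L T) \<xi> \<longrightarrow>
        measure M {\<omega> \<in> space M.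
          avg_gradient_norm F
            (minibatch_nsgd G x1 (nsgd_step \<Delta>\<^sub>1 L T) (nsgd_batch p \<sigma> \<Delta>\<^sub>1 L T) \<xi>) T \<omega>
          \<le> (11 + 30 * ln (1 / \<delta>)) * (sqrt (\<Delta>\<^sub>1 * L) / sqrt (real T))} \<ge> 1 - \<delta>) \<and>
     (\<forall>\<epsilon> T (M :: 'w measure) \<xi>.
        0 < \<epsilon> \<longrightarrow> T = nsgd_horizon \<Delta>\<^sub>1 L \<delta> \<epsilon> \<longrightarrow>
        independent_copies M D T (nsgd_batch p \<sigma> \<Delta>\<^sub>1 L T) \<xi> \<longrightarrow>
        1 \<le> T \<and>
        measure M {\<omega> \<in> space M.
          avg_gradient_norm F
            (minibatch_nsgd G x1 (nsgd_step \<Delta>\<^sub>1 L T) (nsgd_batch p \<sigma> \<Delta>\<^sub>1 L T) \<xi>) T \<omega>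
          \<le> \<epsilon>} \<ge> 1 - \<delta>) \<and>
     (\<exists>C k :: real \<Rightarrow> real. \<forall>\<Delta>>0. \<forall>\<L>>0. \<forall>s\<ge>0. \<exists>\<epsilon>\<^sub>0>0. \<forall>q d \<epsilon> T.
        1 < q \<longrightarrow> q \<le> 2 \<longrightarrow> 0 < d \<longrightarrow> d < 1 \<longrightarrow> 0 < \<epsilon> \<longrightarrow> \<epsilon> < \<epsilon>\<^sub>0 \<longrightarrow>
        T = nsgd_horizon \<Delta> \<L> d \<epsilon> \<longrightarrow>
        real (oracle_calls (nsgd_batch q s \<Delta> \<L> T) T)
          \<le> C q * (1 + ln (1 / d)) powr k q *
            (\<Delta> * \<L> / \<epsilon>\<^sup>2 + \<Delta> * \<L> / \<epsilon>\<^sup>2 * (s / \<epsilon>) powr (q / (q - 1))))"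
proof (intro conjI)
  note hp = nsgd_high_probability[OF assms(1)[rule_format] assms(2-)]
  show "\<forall>T (M :: 'w measure) \<xi>.
        1 \<le> T \<longrightarrow> independent_copies M D T (nsgd_batch p \<sigma> \<Delta>\<^sub>1 L T) \<xi> \<longrightarrow>
        measure M {\<omega> \<in> space M.
          avg_gradient_norm F
            (minibatch_nsgd G x1 (nsgd_step \<Delta>\<^sub>1 L T) (nsgd_batch p \<sigma> \<Delta>\<^sub>1 L T) \<xi>) T \<omega>
          \<le> (11 + 30 * ln (1 / \<delta>)) * (sqrt (\<Delta>\<^sub>1 * L) / sqrt (real T))} \<ge> 1 - \<delta>"
    using hp[OF _ _ order.refl] by blast
  show "\<forall>\<epsilon> T (M :: 'w measure) \<xi>.
        0 < \<epsilon> \<longrightarrow> T = nsgd_horizon \<Delta>\<^sub>1 L \<delta> \<epsilon> \<longrightarrow>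
        independent_copies M D T (nsgd_batch p \<sigma> \<Delta>\<^sub>1 L T) \<xi> \<longrightarrow>
        1 \<le> T \<and>
        measure M {\<omega> \<in> space M.
          avg_gradient_norm F
            (minibatch_nsgd G x1 (nsgd_step \<Delta>\<^sub>1 L T) (nsgd_batch p \<sigma> \<Delta>\<^sub>1 L T) \<xi>) T \<omega>
          \<le> \<epsilon>} \<ge> 1 - \<delta>"
  proof (intro allI impI conjI)
    fix \<epsilon> :: real and T and M :: "'w measure" and \<xi>
    assume \<epsilon>: "0 < \<epsilon>" and T: "T = nsgd_horizon \<Delta>\<^sub>1 L \<delta> \<epsilon>"
      and \<xi>: "independent_copies M D T (nsgd_batch p \<sigma> \<Delta>\<^sub>1 L T) \<xi>"
    define r where "r = 11 + 30 * ln (1 / \<delta>)"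
    have r: "0 < r" using assms by (simp add: r_def add_pos_nonneg)
    have "0 < r\<^sup>2 * (\<Delta>\<^sub>1 * L) / \<epsilon>\<^sup>2" using r \<epsilon> assms by simp
    moreover have T': "r\<^sup>2 * (\<Delta>\<^sub>1 * L) / \<epsilon>\<^sup>2 \<le> real T"
      unfolding T nsgd_horizon_def r_def by linarith
    ultimately show T1: "1 \<le> T" by linarith
    \<comment> \<open>The square root of \<open>T'\<close> puts the rate at or below
      \<open>\<epsilon>\<close>, as required of the threshold \<open>c\<close> in
      \<open>hp\<close>.\<close>
    have "r * sqrt (\<Delta>\<^sub>1 * L) = sqrt (r\<^sup>2 * (\<Delta>\<^sub>1 * L))" using r by (simp add: real_sqrt_mult)
    also have "\<dots> \<le> sqrt (\<epsilon>\<^sup>2 * real T)"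
      using T' \<epsilon> by (intro real_sqrt_le_mono) (simp add: field_simps)
    also have "\<dots> = \<epsilon> * sqrt (real T)" using \<epsilon> by (simp add: real_sqrt_mult)
    finally have "r * (sqrt (\<Delta>\<^sub>1 * L) / sqrt (real T)) \<le> \<epsilon>"
      using T1 by (simp add: divide_le_eq)
    then show "1 - \<delta> \<le> measure M {\<omega> \<in> space M.
          avg_gradient_norm F
            (minibatch_nsgd G x1 (nsgd_step \<Delta>\<^sub>1 L T) (nsgd_batch p \<sigma> \<Delta>\<^sub>1 L T) \<xi>) T \<omega>
          \<le> \<epsilon>}"
      unfolding r_def by (rule hp[OF T1 \<xi>])
  qed
  show "\<exists>C k :: real \<Rightarrow> real. \<forall>\<Delta>>0. \<forall>\<L>>0. \<forall>s\<ge>0. \<exists>\<epsilon>\<^sub>0>0. \<forall>q d \<epsilon> T.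
        1 < q \<longrightarrow> q \<le> 2 \<longrightarrow> 0 < d \<longrightarrow> d < 1 \<longrightarrow> 0 < \<epsilon> \<longrightarrow> \<epsilon> < \<epsilon>\<^sub>0 \<longrightarrow>
        T = nsgd_horizon \<Delta> \<L> d \<epsilon> \<longrightarrow>
        real (oracle_calls (nsgd_batch q s \<Delta> \<L> T) T)
          \<le> C q * (1 + ln (1 / d)) powr k q *
            (\<Delta> * \<L> / \<epsilon>\<^sup>2 + \<Delta> * \<L> / \<epsilon>\<^sup>2 * (s / \<epsilon>) powr (q / (q - 1)))"
  proof (rule exI[of _ "\<lambda>q. 4 * 30\<^sup>2 * (sqrt 2 * 30) powr (q / (q - 1))"],
      rule exI[of _ "\<lambda>q. 2 + q / (q - 1)"], intro allI impI)
    fix \<Delta> \<L> s :: real assume pos: "0 < \<Delta>" "0 < \<L>" "0 \<le> s"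
    \<comment> \<open>Below the threshold \<open>sqrt (\<Delta> * \<L>)\<close> the noiseless
      complexity \<open>\<Delta> * \<L> / \<epsilon>\<^sup>2\<close> exceeds \<open>1\<close>, so
      rounding is absorbed.\<close>
    show "\<exists>\<epsilon>\<^sub>0>0. \<forall>q d \<epsilon> T.
        1 < q \<longrightarrow> q \<le> 2 \<longrightarrow> 0 < d \<longrightarrow> d < 1 \<longrightarrow> 0 < \<epsilon> \<longrightarrow> \<epsilon> < \<epsilon>\<^sub>0 \<longrightarrow>
        T = nsgd_horizon \<Delta> \<L> d \<epsilon> \<longrightarrow>
        real (oracle_calls (nsgd_batch q s \<Delta> \<L> T) T)
          \<le> (4 * 30\<^sup>2 * (sqrt 2 * 30) powr (q / (q - 1))) * (1 + ln (1 / d)) powr (2 + q / (q - 1)) *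
            (\<Delta> * \<L> / \<epsilon>\<^sup>2 + \<Delta> * \<L> / \<epsilon>\<^sup>2 * (s / \<epsilon>) powr (q / (q - 1)))"
      by (intro exI[of _ "sqrt (\<Delta> * \<L>)"] conjI allI impI, use pos in simp) (rule oracle_calls_le[OF _ _ _ pos])
  qed
qed

end
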